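(* Fix an integer $k\ge 2$. For $n\ge 1$ let $f_k(n)$ denote the maximum capture time of an $n$-vertex (finite, undirected) graph with cop number $k$. Then $f_k(n)=\Theta(n^{k+1})$; that is, the maximum capture time of an $n$-vertex graph with cop number $k$ is $\Theta(n^{k+1})$.
   Context: Ordinary Cops and Robbers on a graph $G$: $k$ cops first choose vertices, then the robber chooses a vertex; the game then proceeds in rounds, each consisting of a cop turn (each cop stays put or moves to an adjacent vertex) followed by a robber turn (the robber stays put or moves to an adjacent vertex). The cops win if some cop occupies the robber's vertex. The cop number $c(G)$ is the least number of cops that can guarantee capture. The capture time $\mathrm{capt}(G)$ is the least $t$ such that $c(G)$ cops can always capture the robber within $t$ rounds regardless of the robber's play (choosing initial positions does not count as a round). *)

theory Defs
  imports "Graph_Theory.Pair_Digraph" "HOL-Library.Landau_Symbols"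
begin

text \<open>
  Finite undirected graphs are the graphs of the Graph_Theory library in pair form
  (\<^const>\<open>pair_graph\<close>): finite, loop-free, with a symmetric arc relation.  Connectedness is not
  assumed.
\<close>

definition legal_move :: "'a pair_pre_digraph \<Rightarrow> 'a \<Rightarrow> 'a \<Rightarrow> bool" where
  "legal_move G u v \<longleftrightarrow> u \<in> pverts G \<and> v \<in> pverts G \<and> (u = v \<or> (u, v) \<in> parcs G)"

text \<open>
  A strategy \<open>\<sigma>\<close> for \<open>k\<close> cops maps the list of vertices the robber has occupied so far, oldest
  first, to the cops' positions: \<open>\<sigma> []\<close> is the initial placement and \<open>\<sigma> [r\<^sub>0, \<dots>, r\<^sub>t]\<close> is the
  placement after the cop turn of round \<open>t + 1\<close>.  Cops are indexed by \<open>i < k\<close>; values at other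
  indices are irrelevant, and several cops may share a vertex.
\<close>

definition cop_strategy ::
    "'a pair_pre_digraph \<Rightarrow> nat \<Rightarrow> ('a list \<Rightarrow> nat \<Rightarrow> 'a) \<Rightarrow> bool" where
  "cop_strategy G k \<sigma> \<longleftrightarrow>
     (\<forall>i<k. \<sigma> [] i \<in> pverts G) \<and>
     (\<forall>rs x. set (rs @ [x]) \<subseteq> pverts G \<longrightarrow>
        (\<forall>i<k. legal_move G (\<sigma> rs i) (\<sigma> (rs @ [x]) i)))"

text \<open>
  \<open>r 0\<close> is the robber's initial vertex, \<open>r t\<close> his vertex after round \<open>t\<close>.
  Plays are formally continued after a capture, which has no influence on when it happens.
\<close>

definition robber_play :: "'a pair_pre_digraph \<Rightarrow> (nat \<Rightarrow> 'a) \<Rightarrow> bool" where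
  "robber_play G r \<longleftrightarrow> r 0 \<in> pverts G \<and> (\<forall>t. legal_move G (r t) (r (Suc t)))"

text \<open>
  Some cop shares the robber's vertex in round \<open>t\<close>, where round \<open>0\<close> is the initial placement.
  In a later round this can happen after the cop turn (the robber still being where he was at the
  end of the previous round) or after the robber turn.
\<close>

fun capture_in_round :: "nat \<Rightarrow> ('a list \<Rightarrow> nat \<Rightarrow> 'a) \<Rightarrow> (nat \<Rightarrow> 'a) \<Rightarrow> nat \<Rightarrow> bool" where
  "capture_in_round k \<sigma> r 0 \<longleftrightarrow> (\<exists>i<k. \<sigma> [] i = r 0)"
| "capture_in_round k \<sigma> r (Suc t) \<longleftrightarrow>
     (\<exists>i<k. \<sigma> (map r [0..<Suc t]) i = r t \<or> \<sigma> (map r [0..<Suc t]) i = r (Suc t))"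

definition cops_win :: "'a pair_pre_digraph \<Rightarrow> nat \<Rightarrow> bool" where
  "cops_win G k \<longleftrightarrow>
     (\<exists>\<sigma>. cop_strategy G k \<sigma> \<and>
        (\<forall>r. robber_play G r \<longrightarrow> (\<exists>t. capture_in_round k \<sigma> r t)))"

definition cops_win_within :: "'a pair_pre_digraph \<Rightarrow> nat \<Rightarrow> nat \<Rightarrow> bool" where
  "cops_win_within G k T \<longleftrightarrow>
     (\<exists>\<sigma>. cop_strategy G k \<sigma> \<and>
        (\<forall>r. robber_play G r \<longrightarrow> (\<exists>t\<le>T. capture_in_round k \<sigma> r t)))"

definition cop_number :: "'a pair_pre_digraph \<Rightarrow> nat" where
  "cop_number G = (LEAST k. cops_win G k)"

definition capture_time :: "'a pair_pre_digraph \<Rightarrow> nat" where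
  "capture_time G = (LEAST T. cops_win_within G (cop_number G) T)"

text \<open>
  Every finite graph is isomorphic to one whose vertices are natural numbers.
  For \<open>n\<close> so small that no \<open>n\<close>-vertex graph has cop number \<open>k\<close> the maximum does not exist, and
  the value below is unspecified.
\<close>

definition max_capture_time :: "nat \<Rightarrow> nat \<Rightarrow> nat" where
  "max_capture_time k n =
     Max {capture_time G | G :: nat pair_pre_digraph.
            pair_graph G \<and> card (pverts G) = n \<and> cop_number G = k}"

end

theory Submission
  imports Defs
begin

text \<open>
  Upper bound: among the at most $n^k$ cop positions and $n$ robber positions, the set of
  configurations from which the cops win within $t$ rounds grows strictly with $t$ until it is stable.

  Lower bound: the cops are forced to run an odometer.  Each of the \<open>k\<close> cops owns a track of
  length $\Theta(M)$, and the robber sits on a ring of length $\Theta(M)$.  The phase of the first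
  cop (a residue mod 3) controls all ring vertices of the other two residues, so by rotating it the
  cops push the robber step by step around the ring.  As soon as some track is deserted, the robber
  flees to the haven of this track.  An alarm vertex is left uncontrolled whenever a cop passes a
  gate of her track although the digit below (the previous cop, or the robber on his ring) is not
  at the correct end, so each cop can advance only once for every full sweep of the digit below.
  A robber who has reached a haven or an alarm vertex waits in a vault until the last cop has returned
  to the beginning of her track, and only then re-enters the ring.  The robber is caught only when the last cop reaches
  the end of her track, which takes $\Omega(M^{k+1})$ rounds.

  So that cops who have left their tracks cannot block the way to a haven, every robber vertex is
  blown up by points $(x, y)$, adjacent points satisfying $y + y' = a a'$ modulo $q$ for labels
  $a$, $a'$; then two points with different labels have at most one common neighbour of each label.
  A hub adjacent to everything but the havens allows two cops to trap a robber who enters a track,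
  and leaves attached to the hub adjust the number of vertices.
\<close>

section \<open>Winning configurations\<close>

definition caught :: "nat \<Rightarrow> (nat \<Rightarrow> 'a) \<Rightarrow> 'a \<Rightarrow> bool" where
  "caught k P r \<longleftrightarrow> (\<exists>i<k. P i = r)"

definition cop_turn :: "'a pair_pre_digraph \<Rightarrow> nat \<Rightarrow> (nat \<Rightarrow> 'a) \<Rightarrow> (nat \<Rightarrow> 'a) \<Rightarrow> bool" where
  "cop_turn G k P P' \<longleftrightarrow> (\<forall>i<k. legal_move G (P i) (P' i))"

text \<open>The cops are to move from \<open>P\<close> and have \<open>n\<close> rounds left.\<close>

fun win_in :: "'a pair_pre_digraph \<Rightarrow> nat \<Rightarrow> nat \<Rightarrow> (nat \<Rightarrow> 'a) \<Rightarrow> 'a \<Rightarrow> bool" where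
  "win_in G k 0 P r \<longleftrightarrow> caught k P r"
| "win_in G k (Suc n) P r \<longleftrightarrow> win_in G k n P r \<or>
     (\<exists>P'. cop_turn G k P P' \<and>
        (caught k P' r \<or> (\<forall>r'. legal_move G r r' \<longrightarrow> win_in G k n P' r')))"

lemma legal_moveD: "legal_move G u v \<Longrightarrow> u \<in> pverts G" "legal_move G u v \<Longrightarrow> v \<in> pverts G"
  by (auto simp: legal_move_def)

lemma legal_move_refl [simp]: "legal_move G u u \<longleftrightarrow> u \<in> pverts G"
  by (auto simp: legal_move_def)

lemma win_in_mono: "win_in G k m P r \<Longrightarrow> m \<le> n \<Longrightarrow> win_in G k n P r"
  using lift_Suc_mono_le[of "\<lambda>n. win_in G k n P r" m n] by (simp add: le_fun_def)

lemma caught_cong: "(\<And>i. i < k \<Longrightarrow> P i = Q i) \<Longrightarrow> caught k P r = caught k Q r"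
  by (auto simp: caught_def)

lemma cop_turn_cong:
  "(\<And>i. i < k \<Longrightarrow> P i = Q i) \<Longrightarrow> (\<And>i. i < k \<Longrightarrow> P' i = Q' i) \<Longrightarrow>
    cop_turn G k P P' = cop_turn G k Q Q'"
  by (auto simp: cop_turn_def)

lemma win_in_cong:
  assumes "\<And>i. i < k \<Longrightarrow> P i = Q i"
  shows "win_in G k n P r = win_in G k n Q r"
proof (induction n)
  case 0
  then show ?case using caught_cong[of k P Q] assms by simp
next
  case (Suc n)
  have "cop_turn G k P P' = cop_turn G k Q P'" for P'
    by (rule cop_turn_cong) (use assms in auto)
  then show ?case using Suc by simp
qed

text \<open>A strategy may depend on the whole history, so the robber's play is grown as a list of
  past positions, each new vertex being chosen to keep the invariant \<open>Q\<close>, which sees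
  only the round and the current positions.\<close>

lemma robber_evades:
  assumes \<sigma>: "cop_strategy G k \<sigma>"
    and r0: "r0 \<in> pverts G" and Q0: "Q 0 (\<sigma> []) r0"
    and step: "\<And>t P P' r. \<lbrakk>Q t P r; r \<in> pverts G; cop_turn G k P P'\<rbrakk>
      \<Longrightarrow> \<exists>r'. legal_move G r r' \<and> Q (Suc t) P' r'"
  obtains r where "robber_play G r" "\<And>t. Q t (\<sigma> (map r [0..<t])) (r t)"
    "\<And>t. cop_turn G k (\<sigma> (map r [0..<t])) (\<sigma> (map r [0..<Suc t]))"
proof -
  define nxt where "nxt t h = (SOME r'. legal_move G (last h) r' \<and> Q (Suc t) (\<sigma> h) r')" for t h
  define h where "h = rec_nat [r0] (\<lambda>t hs. hs @ [nxt t hs])"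
  have h0: "h 0 = [r0]" and hS: "h (Suc t) = h t @ [nxt t (h t)]" for t
    by (simp_all add: h_def)
  define r where "r t = last (h t)" for t
  have hr: "h t = map r [0..<Suc t]" for t
  proof (induction t)
    case (Suc t)
    then show ?case by (simp add: hS r_def)
  qed (simp add: h0 r_def)
  have r_Suc: "r (Suc t) = (SOME x. legal_move G (r t) x \<and> Q (Suc t) (\<sigma> (h t)) x)" for t :: nat
    by (simp add: r_def hS nxt_def)
  have main: "set (map r [0..<Suc t]) \<subseteq> pverts G \<and> Q t (\<sigma> (map r [0..<t])) (r t)" for t
  proof (induction t)
    case 0
    then show ?case using r0 Q0 by (simp add: r_def h0)
  next
    case (Suc t)
    have "cop_turn G k (\<sigma> (map r [0..<t])) (\<sigma> (map r [0..<t] @ [r t]))"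
      using \<sigma> Suc unfolding cop_strategy_def cop_turn_def by fastforce
    then have "\<exists>r'. legal_move G (r t) r' \<and> Q (Suc t) (\<sigma> (map r [0..<t] @ [r t])) r'"
      using Suc by (intro step) auto
    then have "\<exists>r'. legal_move G (r t) r' \<and> Q (Suc t) (\<sigma> (h t)) r'"
      by (simp add: hr)
    then have "legal_move G (r t) (r (Suc t)) \<and> Q (Suc t) (\<sigma> (h t)) (r (Suc t))"
      unfolding r_Suc by (rule someI_ex)
    then show ?case using Suc unfolding hr by (auto dest: legal_moveD)
  qed
  have turn: "cop_turn G k (\<sigma> (map r [0..<t])) (\<sigma> (map r [0..<Suc t]))" for t
    using \<sigma> main[of t] unfolding cop_strategy_def cop_turn_def by fastforce
  have "legal_move G (r t) (r (Suc t))" for t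
  proof -
    have "\<exists>r'. legal_move G (r t) r' \<and> Q (Suc t) (\<sigma> (map r [0..<Suc t])) r'"
      using main[of t] by (intro step[OF _ _ turn]) auto
    then have "\<exists>r'. legal_move G (r t) r' \<and> Q (Suc t) (\<sigma> (h t)) r'"
      by (simp only: hr)
    then have "legal_move G (r t) (r (Suc t)) \<and> Q (Suc t) (\<sigma> (h t)) (r (Suc t))"
      unfolding r_Suc by (rule someI_ex)
    then show ?thesis ..
  qed
  moreover have "r 0 \<in> pverts G" using main[of 0] by simp
  ultimately have "robber_play G r" by (simp add: robber_play_def)
  then show thesis using main turn that by blast
qed

text \<open>Greedy play: in a won configuration the cops always lower the least number of rounds in
  which they can still win. This rule looks only at current positions and respects every bound
  \<open>n\<close> at once.\<close>

lemma win_in_strategy: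
  assumes P0: "\<forall>i<k. P0 i \<in> pverts G"
  obtains \<sigma> where "cop_strategy G k \<sigma>" "\<sigma> [] = P0"
    "\<And>r t n. robber_play G r \<Longrightarrow> win_in G k n (\<sigma> (map r [0..<t])) (r t)
       \<Longrightarrow> \<exists>s\<le>t + n. capture_in_round k \<sigma> r s"
proof -
  define good where "good P x P' \<longleftrightarrow> cop_turn G k P P' \<and> (caught k P' x \<or>
     (\<exists>m. Suc m = (LEAST n. win_in G k n P x) \<and> (\<forall>r'. legal_move G x r' \<longrightarrow> win_in G k m P' r')))"
    for P x P'
  \<comment> \<open>Without a good turn the cops stand still, so that \<open>best\<close> is always
    legal.\<close>
  define best where "best P x = (if \<exists>P'. good P x P' then SOME P'. good P x P' else P)" for P x
  have best: "good P x (best P x)" if "good P x P'" for P x P'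
    using that someI[of "good P x"] by (auto simp: best_def)
  define \<sigma> where "\<sigma> = foldl best P0"
  have [simp]: "\<sigma> [] = P0" "\<sigma> (rs @ [x]) = best (\<sigma> rs) x" for rs x
    by (simp_all add: \<sigma>_def)
  have turn: "cop_turn G k P (best P x)" if "\<forall>i<k. P i \<in> pverts G" for P x
  proof (cases "\<exists>P'. good P x P'")
    case True
    then show ?thesis using best good_def by blast
  next
    case False
    then show ?thesis using that by (simp add: best_def cop_turn_def)
  qed
  have V: "\<forall>i<k. \<sigma> rs i \<in> pverts G" for rs
  proof (induction rs rule: rev_induct)
    case Nil
    then show ?case using P0 by simp
  next
    case (snoc x xs)
    then show ?case using turn[of "\<sigma> xs" x] by (auto simp: cop_turn_def dest: legal_moveD)
  qed
  have "cop_strategy G k \<sigma>"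
    unfolding cop_strategy_def using P0 V turn by (auto simp: cop_turn_def)
  moreover have "\<exists>s\<le>t + n. capture_in_round k \<sigma> r s"
    if play: "robber_play G r" and "win_in G k n (\<sigma> (map r [0..<t])) (r t)" for r t n
    using that(2)
  proof (induction n arbitrary: t rule: less_induct)
    case (less n)
    let ?P = "\<sigma> (map r [0..<t])"
    define m where "m = (LEAST n. win_in G k n ?P (r t))"
    have m: "win_in G k m ?P (r t)" "m \<le> n"
      unfolding m_def using less.prems by (auto intro: LeastI Least_le)
    have before: "\<not> win_in G k j ?P (r t)" if "j < m" for j
      using that not_less_Least unfolding m_def by blast
    show ?case
    proof (cases m)
      case 0
      then have "capture_in_round k \<sigma> r t"
        using m by (cases t) (auto simp: caught_def)
      then show ?thesis by (intro exI[of _ t]) simp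
    next
      case (Suc m')
      then have "\<exists>P'. good ?P (r t) P'"
        using m before[of m'] unfolding good_def m_def[symmetric] by auto
      then have g: "good ?P (r t) (\<sigma> (map r [0..<Suc t]))"
        using best by auto
      show ?thesis
      proof (cases "caught k (\<sigma> (map r [0..<Suc t])) (r t)")
        case True
        then have "capture_in_round k \<sigma> r (Suc t)" by (auto simp: caught_def)
        then show ?thesis using Suc m by (intro exI[of _ "Suc t"]) simp
      next
        case False
        then have "\<forall>r'. legal_move G (r t) r' \<longrightarrow> win_in G k m' (\<sigma> (map r [0..<Suc t])) r'"
          using g Suc unfolding good_def m_def[symmetric] by auto
        then have "win_in G k m' (\<sigma> (map r [0..<Suc t])) (r (Suc t))"
          using play by (auto simp: robber_play_def)
        from less.IH[OF _ this] Suc m obtain s where "s \<le> Suc t + m'" "capture_in_round k \<sigma> r s"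
          by auto
        then show ?thesis using Suc m by (intro exI[of _ s]) simp
      qed
    qed
  qed
  ultimately show thesis using that[of \<sigma>] by simp
qed

lemma capture_in_round_caught:
  "capture_in_round k \<sigma> r t \<Longrightarrow>
    caught k (\<sigma> (map r [0..<t])) (r t) \<or> (\<exists>s. t = Suc s \<and> caught k (\<sigma> (map r [0..<t])) (r s))"
  by (cases t) (auto simp: caught_def)

text \<open>History gives the cops no advantage: from a placement that is not won, the robber keeps
  \<open>win_in\<close> false for the remaining number of rounds against any strategy.\<close>

lemma cops_win_within_iff:
  "cops_win_within G k T \<longleftrightarrow>
    (\<exists>P0. (\<forall>i<k. P0 i \<in> pverts G) \<and> (\<forall>r\<in>pverts G. win_in G k T P0 r))" (is "?L \<longleftrightarrow> ?R")
proof
  assume ?R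
  then obtain P0 where P0: "\<forall>i<k. P0 i \<in> pverts G" "\<forall>r\<in>pverts G. win_in G k T P0 r"
    by blast
  from win_in_strategy[OF P0(1)] obtain \<sigma> where
    \<sigma>: "cop_strategy G k \<sigma>" "\<sigma> [] = P0"
    "\<And>r t n. robber_play G r \<Longrightarrow> win_in G k n (\<sigma> (map r [0..<t])) (r t)
       \<Longrightarrow> \<exists>s\<le>t + n. capture_in_round k \<sigma> r s"
    by blast
  have "\<exists>t\<le>T. capture_in_round k \<sigma> r t" if "robber_play G r" for r
    using \<sigma>(3)[OF that, of T 0] that \<sigma>(2) P0(2) by (auto simp: robber_play_def)
  then show ?L using \<sigma>(1) unfolding cops_win_within_def by blast
next
  assume ?L
  then obtain \<sigma> where \<sigma>: "cop_strategy G k \<sigma>"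
    and cap: "\<And>r. robber_play G r \<Longrightarrow> \<exists>t\<le>T. capture_in_round k \<sigma> r t"
    unfolding cops_win_within_def by blast
  show ?R
  proof (rule ccontr)
    assume "\<not> ?R"
    then obtain r0 where r0: "r0 \<in> pverts G" "\<not> win_in G k T (\<sigma> []) r0"
      using \<sigma> unfolding cop_strategy_def by blast
    \<comment> \<open>Rounds after \<open>T\<close> impose nothing; a play goes on for ever, and
      there the robber may stay put.\<close>
    define Q where "Q t P r \<longleftrightarrow> (t \<le> T \<longrightarrow> \<not> win_in G k (T - t) P r)" for t P r
    have Q0: "Q 0 (\<sigma> []) r0"
      using r0(2) by (simp add: Q_def)
    have step: "\<exists>r'. legal_move G r r' \<and> Q (Suc t) P' r'"
      if "Q t P r" "r \<in> pverts G" "cop_turn G k P P'" for t P P' r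
    proof (cases "t < T")
      case True
      then have "T - t = Suc (T - Suc t)" by simp
      then show ?thesis using that True unfolding Q_def by auto
    next
      case False
      then show ?thesis using that by (intro exI[of _ r]) (auto simp: Q_def)
    qed
    obtain r where
      r: "robber_play G r" "\<And>t. Q t (\<sigma> (map r [0..<t])) (r t)"
      "\<And>t. cop_turn G k (\<sigma> (map r [0..<t])) (\<sigma> (map r [0..<Suc t]))"
      by (rule robber_evades[where Q = Q, OF \<sigma> r0(1) Q0]) (erule (2) step, blast)
    obtain t where t: "t \<le> T" "capture_in_round k \<sigma> r t"
      using cap[OF r(1)] by blast
    from capture_in_round_caught[OF t(2)] show False
    proof (elim disjE exE conjE)
      assume "caught k (\<sigma> (map r [0..<t])) (r t)"
      then have "win_in G k (T - t) (\<sigma> (map r [0..<t])) (r t)"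
        using win_in_mono[of G k 0] by simp
      then show False using r(2)[of t] t(1) by (simp add: Q_def)
    next
      fix s assume s: "t = Suc s" "caught k (\<sigma> (map r [0..<t])) (r s)"
      then have "T - s = Suc (T - t)" using t by simp
      then have "win_in G k (T - s) (\<sigma> (map r [0..<s])) (r s)"
        using r(3)[of s] s by auto
      then show False using r(2)[of s] t(1) s(1) by (simp add: Q_def)
    qed
  qed
qed

text \<open>Level \<open>n + 1\<close> of \<open>win_in\<close> is determined by level
  \<open>n\<close>, so the chain of sets of won configurations is strict until it stops for
  good.\<close>

lemma win_in_bounded:
  assumes fin: "finite (pverts G)" and P: "\<forall>i<k. P i \<in> pverts G" and r: "r \<in> pverts G"
    and win: "win_in G k n P r"
  shows "win_in G k (card (pverts G) ^ (k + 1)) P r"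
proof -
  \<comment> \<open>Restricting positions to the indices below \<open>k\<close> makes the set of
    configurations finite.\<close>
  define St where "St = PiE {..<k} (\<lambda>_. pverts G) \<times> pverts G"
  define S where "S n = {(P, r) \<in> St. win_in G k n P r}" for n
  have restr: "win_in G k n (restrict P {..<k}) r = win_in G k n P r" for P r n
    by (rule win_in_cong) simp
  have S_iff: "win_in G k n P r \<longleftrightarrow> (restrict P {..<k}, r) \<in> S n"
    if "\<forall>i<k. P i \<in> pverts G" "r \<in> pverts G" for P r n
    using that by (auto simp: S_def St_def restr)
  have stable: "S (Suc n) = S (Suc (Suc n))" if "S n = S (Suc n)" for n
  proof -
    have "win_in G k n P' r' = win_in G k (Suc n) P' r'"
      if "cop_turn G k P P'" "legal_move G r r'" for P P' r r'
      using that \<open>S n = S (Suc n)\<close>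
        S_iff[of P' r' n] S_iff[of P' r' "Suc n"] by (auto simp: cop_turn_def dest: legal_moveD)
    then have "win_in G k (Suc (Suc n)) P r \<longrightarrow> win_in G k (Suc n) P r" for P r
      by (subst win_in.simps(2)) (metis win_in.simps(2))
    then have "win_in G k (Suc (Suc n)) P r = win_in G k (Suc n) P r" for P r
      using win_in_mono[of G k "Suc n" P r "Suc (Suc n)"] by auto
    then show ?thesis by (simp add: S_def)
  qed
  have "finite St" using fin by (simp add: St_def finite_PiE)
  have "mono S" unfolding S_def by (intro monoI) (auto intro: win_in_mono)
  have "S (card St) = (\<Union>n. S n)"
  proof (rule finite_mono_strict_prefix_implies_finite_fixpoint)
    show "\<exists>N. (\<forall>n\<le>N. \<forall>m\<le>N. m < n \<longrightarrow> S m \<subset> S n) \<and> (\<forall>n\<ge>N. S N = S n)"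
    proof (rule finite_mono_remains_stable_implies_strict_prefix)
      show "finite (range S)"
        by (rule finite_subset[of _ "Pow St"]) (use \<open>finite St\<close> in \<open>auto simp: S_def\<close>)
    qed (use \<open>mono S\<close> stable in auto)
  qed (use \<open>finite St\<close> in \<open>auto simp: S_def\<close>)
  moreover have "card St = card (pverts G) ^ (k + 1)"
    by (simp add: St_def card_cartesian_product card_PiE)
  ultimately show ?thesis using S_iff[OF P r] win by auto
qed

text \<open>If the bound failed, the robber would have a start from which he could for ever avoid
  all configurations won in any number of rounds.\<close>

lemma cops_win_imp_within:
  assumes fin: "finite (pverts G)" and win: "cops_win G k"
  shows "cops_win_within G k (card (pverts G) ^ (k + 1))"
proof (rule ccontr)
  let ?N = "card (pverts G) ^ (k + 1)"
  assume not: "\<not> ?thesis"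
  obtain \<sigma> where \<sigma>: "cop_strategy G k \<sigma>"
    and cap: "\<And>r. robber_play G r \<Longrightarrow> \<exists>t. capture_in_round k \<sigma> r t"
    using win unfolding cops_win_def by blast
  obtain r0 where r0: "r0 \<in> pverts G" "\<not> win_in G k ?N (\<sigma> []) r0"
    using \<sigma> not unfolding cop_strategy_def cops_win_within_iff by blast
  define Q where "Q t P r \<longleftrightarrow> (\<forall>i<k. P i \<in> pverts G) \<and> (\<forall>n. \<not> win_in G k n P r)" for t :: nat and P r
  have Q_bound: "Q t P r" if "\<forall>i<k. P i \<in> pverts G" "r \<in> pverts G" "\<not> win_in G k ?N P r" for t P r
    using that win_in_bounded[OF fin] by (auto simp: Q_def)
  have Q0: "Q 0 (\<sigma> []) r0"
    using Q_bound r0 \<sigma> by (simp add: cop_strategy_def)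
  have step: "\<exists>r'. legal_move G r r' \<and> Q (Suc t) P' r'"
    if Q: "Q t P r" and r: "r \<in> pverts G" and turn: "cop_turn G k P P'" for t P P' r
  proof -
    \<comment> \<open>One reply has to defeat all numbers of rounds simultaneously; by
      \<open>Q_bound\<close> it suffices to defeat \<open>?N\<close>.\<close>
    have "\<not> win_in G k (Suc ?N) P r" using Q by (auto simp only: Q_def)
    then obtain r' where "legal_move G r r'" "\<not> win_in G k ?N P' r'"
      using turn by (simp only: win_in.simps) blast
    moreover have "\<forall>i<k. P' i \<in> pverts G"
      using turn by (auto simp: cop_turn_def dest: legal_moveD)
    ultimately show ?thesis using Q_bound by (blast dest: legal_moveD)
  qed
  obtain r where
      r: "robber_play G r" "\<And>t. Q t (\<sigma> (map r [0..<t])) (r t)"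
      "\<And>t. cop_turn G k (\<sigma> (map r [0..<t])) (\<sigma> (map r [0..<Suc t]))"
    by (rule robber_evades[where Q = Q, OF \<sigma> r0(1) Q0]) (erule (2) step, blast)
  obtain t where t: "capture_in_round k \<sigma> r t"
    using cap[OF r(1)] by blast
  from capture_in_round_caught[OF t] show False
  proof (elim disjE exE conjE)
    assume "caught k (\<sigma> (map r [0..<t])) (r t)"
    then have "win_in G k 0 (\<sigma> (map r [0..<t])) (r t)" by simp
    then show False using r(2)[of t] unfolding Q_def by blast
  next
    fix s assume s: "t = Suc s" "caught k (\<sigma> (map r [0..<t])) (r s)"
    then have "win_in G k (Suc 0) (\<sigma> (map r [0..<s])) (r s)"
      using r(3)[of s] by auto
    then show False using r(2)[of s] unfolding Q_def by blast
  qed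
qed

section \<open>Cop number and capture time as attained minima\<close>

lemma cops_win_within_imp_win: "cops_win_within G k T \<Longrightarrow> cops_win G k"
  unfolding cops_win_within_def cops_win_def by blast

text \<open>One cop on each vertex wins at once, so the \<open>LEAST\<close> in
  \<open>cop_number\<close> is attained.\<close>

lemma cops_win_card:
  assumes "finite (pverts G)"
  shows "cops_win G (card (pverts G))"
proof -
  define c where "c = card (pverts G)"
  obtain P where "bij_betw P {0..<c} (pverts G)"
    using ex_bij_betw_nat_finite[OF assms] unfolding c_def by blast
  then have P: "P ` {0..<c} = pverts G" by (simp add: bij_betw_def)
  have "\<forall>i<c. P i \<in> pverts G" unfolding P[symmetric] by simp
  moreover have "\<forall>r\<in>pverts G. win_in G c 0 P r" unfolding P[symmetric] by (auto simp: caught_def)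
  ultimately have "cops_win_within G (card (pverts G)) 0"
    unfolding cops_win_within_iff c_def by blast
  then show ?thesis by (rule cops_win_within_imp_win)
qed

lemma cops_win_cop_number: "finite (pverts G) \<Longrightarrow> cops_win G (cop_number G)"
  unfolding cop_number_def by (blast intro: LeastI cops_win_card)

lemma cops_win_within_capture_time:
  "finite (pverts G) \<Longrightarrow> cops_win_within G (cop_number G) (capture_time G)"
  unfolding capture_time_def by (blast intro: LeastI cops_win_imp_within cops_win_cop_number)

lemma capture_time_le:
  "finite (pverts G) \<Longrightarrow> capture_time G \<le> card (pverts G) ^ (cop_number G + 1)"
  unfolding capture_time_def by (blast intro: Least_le cops_win_imp_within cops_win_cop_number)

section \<open>Relabelling vertices\<close>

text \<open>The construction below lives on a datatype, whereas \<open>max_capture_time\<close>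
  ranges over graphs on \<open>nat\<close>.\<close>

definition map_graph :: "('a \<Rightarrow> 'b) \<Rightarrow> 'a pair_pre_digraph \<Rightarrow> 'b pair_pre_digraph" where
  "map_graph f G = \<lparr>pverts = f ` pverts G, parcs = map_prod f f ` parcs G\<rparr>"

locale graph_embedding = pair_graph G for G :: "'a pair_pre_digraph" +
  fixes f :: "'a \<Rightarrow> 'b"
  assumes inj: "inj_on f (pverts G)"
begin

lemma pverts_map [simp]: "pverts (map_graph f G) = f ` pverts G"
  by (simp add: map_graph_def)

lemma map_eq_iff: "u \<in> pverts G \<Longrightarrow> v \<in> pverts G \<Longrightarrow> f u = f v \<longleftrightarrow> u = v"
  by (rule inj_on_eq_iff[OF inj])

lemma arc_map_iff:
  assumes "u \<in> pverts G" "v \<in> pverts G"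
  shows "(f u, f v) \<in> parcs (map_graph f G) \<longleftrightarrow> (u, v) \<in> parcs G"
proof
  assume "(f u, f v) \<in> parcs (map_graph f G)"
  then obtain a b where ab: "(a, b) \<in> parcs G" "f u = f a" "f v = f b"
    unfolding map_graph_def by auto
  moreover have "u = a" "v = b"
    using ab in_arcsD1[of a b] in_arcsD2[of a b] assms map_eq_iff by metis+
  ultimately show "(u, v) \<in> parcs G" by simp
next
  assume "(u, v) \<in> parcs G"
  then show "(f u, f v) \<in> parcs (map_graph f G)"
    unfolding map_graph_def by (auto intro!: rev_image_eqI)
qed

lemma legal_move_map:
  "u \<in> pverts G \<Longrightarrow> v \<in> pverts G \<Longrightarrow> legal_move (map_graph f G) (f u) (f v) \<longleftrightarrow> legal_move G u v"
  by (simp add: legal_move_def arc_map_iff map_eq_iff)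

lemma pair_graph_map: "pair_graph (map_graph f G)"
proof
  show "finite (pverts (map_graph f G))"
    using pair_finite_verts by simp
  have "parcs (map_graph f G) = map_prod f f ` parcs G"
    by (simp add: map_graph_def)
  then show "finite (parcs (map_graph f G))"
    using pair_finite_arcs by (metis finite_imageI)
  show "symmetric (with_proj (map_graph f G))"
    unfolding symmetric_def with_proj_simps
  proof (rule symI)
    fix a b assume "(a, b) \<in> parcs (map_graph f G)"
    then obtain u v where "(u, v) \<in> parcs G" "a = f u" "b = f v"
      by (auto simp: map_graph_def)
    then show "(b, a) \<in> parcs (map_graph f G)"
      using arcs_symmetric[of u v] by (force simp: map_graph_def)
  qed
next
  fix e assume "e \<in> parcs (map_graph f G)"
  then obtain u v where uv: "(u, v) \<in> parcs G" "e = (f u, f v)"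
    by (auto simp: map_graph_def)
  show "fst e \<in> pverts (map_graph f G)" "snd e \<in> pverts (map_graph f G)"
    using uv in_arcsD1 in_arcsD2 by auto
  show "fst e \<noteq> snd e"
    using uv in_arcsD1 in_arcsD2 no_loops' by (simp add: map_eq_iff)
qed

lemma win_in_map:
  assumes "\<forall>i<k. P i \<in> pverts G" "r \<in> pverts G"
  shows "win_in (map_graph f G) k n (f \<circ> P) (f r) = win_in G k n P r"
  using assms
proof (induction n arbitrary: P r)
  case 0
  then show ?case by (auto simp: caught_def map_eq_iff)
next
  case (Suc n)
  let ?g = "inv_into (pverts G) f"
  have "(\<exists>P'. cop_turn (map_graph f G) k (f \<circ> P) P' \<and>
        (caught k P' (f r) \<or> (\<forall>r'. legal_move (map_graph f G) (f r) r' \<longrightarrow> win_in (map_graph f G) k n P' r')))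
    \<longleftrightarrow> (\<exists>P'. cop_turn G k P P' \<and> (caught k P' r \<or> (\<forall>r'. legal_move G r r' \<longrightarrow> win_in G k n P' r')))"
    (is "(\<exists>P'. ?A P') \<longleftrightarrow> (\<exists>P'. ?B P')")
  proof -
    have key: "?A (f \<circ> P') \<longleftrightarrow> ?B P'" if V: "\<forall>i<k. P' i \<in> pverts G" for P'
    proof -
      have "cop_turn (map_graph f G) k (f \<circ> P) (f \<circ> P') = cop_turn G k P P'"
        using Suc.prems V by (auto simp: cop_turn_def legal_move_map)
      moreover have "caught k (f \<circ> P') (f r) = caught k P' r"
        using Suc.prems V by (auto simp: caught_def map_eq_iff)
      moreover have "(\<forall>r'. legal_move (map_graph f G) (f r) r' \<longrightarrow> win_in (map_graph f G) k n (f \<circ> P') r')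
          \<longleftrightarrow> (\<forall>r'\<in>pverts G. legal_move (map_graph f G) (f r) (f r') \<longrightarrow> win_in (map_graph f G) k n (f \<circ> P') (f r'))"
        using legal_moveD(2)[of "map_graph f G"] by auto
      moreover have "\<dots> \<longleftrightarrow> (\<forall>r'. legal_move G r r' \<longrightarrow> win_in G k n P' r')"
        using Suc.IH[OF V] Suc.prems legal_moveD(2)[of G r] by (auto simp: legal_move_map comp_def)
      ultimately show ?thesis by simp
    qed
    show ?thesis
    proof
      assume "\<exists>P'. ?A P'"
      then obtain P' where P': "?A P'" by blast
      \<comment> \<open>Positions in the image graph are pulled back by the inverse of
        \<open>f\<close>; the congruence lemmas take care of indices from \<open>k\<close> on, where
        nothing is known.\<close>
      define P'' where "P'' = ?g \<circ> P'"
      have im: "P' i \<in> f ` pverts G" if "i < k" for i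
        using P' that by (auto simp: cop_turn_def dest!: legal_moveD)
      then have eq: "P' i = (f \<circ> P'') i" if "i < k" for i
        using that by (simp add: P''_def f_inv_into_f)
      have "?A (f \<circ> P'')"
        using P' cop_turn_cong[of k "f \<circ> P" "f \<circ> P" P' "f \<circ> P''" "map_graph f G", OF refl eq]
          caught_cong[of k P' "f \<circ> P''", OF eq]
          win_in_cong[of k P' "f \<circ> P''", OF eq] by simp
      moreover have "\<forall>i<k. P'' i \<in> pverts G"
        using im by (simp add: P''_def inv_into_into)
      ultimately show "\<exists>P'. ?B P'" using key by blast
    next
      assume "\<exists>P'. ?B P'"
      then obtain P' where P': "?B P'" by blast
      then have "\<forall>i<k. P' i \<in> pverts G" by (auto simp: cop_turn_def dest: legal_moveD)
      then show "\<exists>P'. ?A P'" using key[of P'] P' by blast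
    qed
  qed
  then show ?case by (simp only: win_in.simps Suc.IH[OF Suc.prems])
qed

lemma cops_win_within_map: "cops_win_within (map_graph f G) k T = cops_win_within G k T"
proof -
  let ?g = "inv_into (pverts G) f"
  have "cops_win_within (map_graph f G) k T \<longleftrightarrow>
      (\<exists>P0. (\<forall>i<k. P0 i \<in> pverts G) \<and> (\<forall>r\<in>pverts G. win_in (map_graph f G) k T (f \<circ> P0) (f r)))"
    (is "_ \<longleftrightarrow> ?R")
  proof
    assume "cops_win_within (map_graph f G) k T"
    then obtain P where P: "\<forall>i<k. P i \<in> f ` pverts G"
      "\<forall>r\<in>pverts G. win_in (map_graph f G) k T P (f r)"
      unfolding cops_win_within_iff by auto
    have "win_in (map_graph f G) k T (f \<circ> (?g \<circ> P)) (f r)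
        = win_in (map_graph f G) k T P (f r)" for r
      by (rule win_in_cong) (use P in \<open>simp add: f_inv_into_f\<close>)
    then show ?R using P by (intro exI[of _ "?g \<circ> P"]) (simp add: inv_into_into)
  next
    assume ?R
    then obtain P0 where "\<forall>i<k. P0 i \<in> pverts G"
      "\<forall>r\<in>pverts G. win_in (map_graph f G) k T (f \<circ> P0) (f r)" by blast
    then show "cops_win_within (map_graph f G) k T"
      unfolding cops_win_within_iff by (intro exI[of _ "f \<circ> P0"]) simp
  qed
  also have "\<dots> \<longleftrightarrow> cops_win_within G k T"
    unfolding cops_win_within_iff using win_in_map by blast
  finally show ?thesis .
qed

text \<open>Strategies are not transported themselves: finiteness reduces an unbounded win to a
  bounded one, which \<open>win_in\<close> describes.\<close>

lemma cops_win_map: "cops_win (map_graph f G) k = cops_win G k"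
proof
  assume "cops_win (map_graph f G) k"
  from cops_win_imp_within[OF _ this] show "cops_win G k"
    using pair_finite_verts cops_win_within_imp_win[of G] by (simp add: cops_win_within_map)
next
  assume "cops_win G k"
  from cops_win_imp_within[OF pair_finite_verts this] show "cops_win (map_graph f G) k"
    using cops_win_within_imp_win[of "map_graph f G"] by (simp add: cops_win_within_map)
qed

lemma cop_number_map: "cop_number (map_graph f G) = cop_number G"
  by (simp add: cop_number_def cops_win_map)

lemma capture_time_map: "capture_time (map_graph f G) = capture_time G"
  by (simp add: capture_time_def cop_number_map cops_win_within_map)

end

section \<open>The odometer graph\<close>

datatype site = Ring nat | Haven nat | Vault | Alarm nat bool

text \<open>\<open>Cop t a f\<close> is position \<open>a\<close> of track \<open>t\<close> in phase
  \<open>f\<close>; \<open>Rob s x y\<close> is the point \<open>(x, y)\<close> of the blown-up site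
  \<open>s\<close>.\<close>

datatype vert = Cop nat nat nat | Rob site nat nat | Hub | Leaf nat

text \<open>\<open>b\<close> names the end at which the digit below has to stand:
  \<open>True\<close> the upper, \<open>False\<close> the lower one.\<close>

definition gate :: "bool \<Rightarrow> nat \<Rightarrow> bool" where
  "gate b a \<longleftrightarrow> (if b then a mod 4 = 2 else a mod 4 = 0 \<and> a > 0)"

lemma not_gate_0 [simp]: "\<not> gate b 0"
  by (simp add: gate_def)

text \<open>
  The value of one digit of the odometer, where \<open>\<phi> \<in> [0, L]\<close> is the value of the digit below.  At the
  positions \<open>4 * c + 1\<close> and \<open>4 * c + 3\<close> of a track the digit below sweeps upwards and downwards,
  respectively; the positions in between are gates, which require \<open>\<phi> = 0\<close> or \<open>\<phi> = L\<close>.  Position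
  \<open>0\<close> is not a gate, since the robber has to be driven out of his havens while the last cop waits
  there; hence positions \<open>0\<close> and \<open>1\<close> both have value \<open>0\<close>, which is the effect of \<^const>\<open>max\<close>.
\<close>

definition level :: "int \<Rightarrow> nat \<Rightarrow> int \<Rightarrow> int" where
  "level L a \<phi> = max 0 (2 * L * int (a div 4) +
     (if a mod 4 = 0 then - L else if a mod 4 = 1 then \<phi> - L else if a mod 4 = 2 then 0 else L - \<phi>))"

lemma level_simps:
  "level L (4 * c) \<phi> = max 0 (2 * L * int c - L)"
  "level L (4 * c + 1) \<phi> = max 0 (2 * L * int c + \<phi> - L)"
  "level L (4 * c + 2) \<phi> = max 0 (2 * L * int c)"
  "level L (4 * c + 3) \<phi> = max 0 (2 * L * int c + L - \<phi>)"
proof -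
  have "(4 * c) div 4 = c" "(4 * c + 1) div 4 = c" "(4 * c + 2) div 4 = c" "(4 * c + 3) div 4 = c"
    "(4 * c) mod 4 = 0" "(4 * c + 1) mod 4 = 1" "(4 * c + 2) mod 4 = 2" "(4 * c + 3) mod 4 = 3"
    by presburger+
  then show "level L (4 * c) \<phi> = max 0 (2 * L * int c - L)"
    "level L (4 * c + 1) \<phi> = max 0 (2 * L * int c + \<phi> - L)"
    "level L (4 * c + 2) \<phi> = max 0 (2 * L * int c)"
    "level L (4 * c + 3) \<phi> = max 0 (2 * L * int c + L - \<phi>)"
    unfolding level_def by simp_all
qed

lemma gate_simps:
  "gate False (4 * c) \<longleftrightarrow> c > 0" "gate True (4 * c + 2)"
  "\<not> gate True (4 * c)" "\<not> gate b (4 * c + 1)" "\<not> gate False (4 * c + 2)" "\<not> gate b (4 * c + 3)"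
  unfolding gate_def by (presburger | (cases b; presburger))+

lemma mod4_cases:
  fixes a :: nat
  obtains c where "a = 4 * c" | c where "a = 4 * c + 1" | c where "a = 4 * c + 2" | c where "a = 4 * c + 3"
proof -
  have "a = 4 * (a div 4) \<or> a = 4 * (a div 4) + 1 \<or> a = 4 * (a div 4) + 2 \<or> a = 4 * (a div 4) + 3"
    by presburger
  then show thesis using that by blast
qed

lemma level_start: "\<phi> \<le> L \<Longrightarrow> 0 \<le> L \<Longrightarrow> a \<le> 1 \<Longrightarrow> level L a \<phi> = 0"
  using level_simps(1,2)[of L 0 \<phi>] by (auto simp: le_Suc_eq)

lemma level_end: "0 \<le> L \<Longrightarrow> level L (4 * m + 2) \<phi> = 2 * int m * L"
  by (simp only: level_simps) (simp add: mult.commute)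

lemma level_nonneg: "0 \<le> level L a \<phi>"
  by (simp add: level_def)

lemma level_le:
  assumes "0 \<le> \<phi>" "\<phi> \<le> L" "a \<le> 4 * m + 2"
  shows "level L a \<phi> \<le> 2 * int m * L"
proof -
  have *: "2 * L * int c \<le> 2 * int m * L" if "c \<le> m" for c
    using that assms by (simp add: mult_mono mult.commute)
  have nonneg: "0 \<le> 2 * int m * L" using assms by simp
  show ?thesis
  proof (cases a rule: mod4_cases)
    case (1 c)
    then show ?thesis using *[of c] nonneg assms by (simp add: level_simps)
  next
    case (2 c)
    then show ?thesis using *[of c] nonneg assms by (simp only: level_simps) simp
  next
    case (3 c)
    then show ?thesis using *[of c] nonneg assms by (simp only: level_simps) simp
  next
    case (4 c)
    then have "Suc c \<le> m" using assms by simp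
    from *[OF this] show ?thesis
      using nonneg assms 4 by (simp only: level_simps) (simp add: algebra_simps)
  qed
qed

lemma max_0_lipschitz: "\<bar>x - y\<bar> \<le> 1 \<Longrightarrow> \<bar>max 0 x - max 0 y\<bar> \<le> (1 :: int)"
  by (auto simp: max_def)

text \<open>At a gate the value below is pinned to \<open>0\<close> or \<open>L\<close>, where the
  formulas of neighbouring positions agree, so only the change from \<phi> to \<psi> is felt.
  Positions \<open>0\<close> and \<open>1\<close> both have value \<open>0\<close>.\<close>

lemma level_lipschitz_Suc:
  assumes "0 \<le> \<phi>" "\<phi> \<le> L" "0 \<le> \<psi>" "\<psi> \<le> L" "\<bar>\<phi> - \<psi>\<bar> \<le> 1"
    and "gate True a \<Longrightarrow> \<phi> = L" "gate False a \<Longrightarrow> \<phi> = 0"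
    and "gate True (Suc a) \<Longrightarrow> \<psi> = L" "gate False (Suc a) \<Longrightarrow> \<psi> = 0"
  shows "\<bar>level L a \<phi> - level L (Suc a) \<psi>\<bar> \<le> 1"
proof (cases a rule: mod4_cases)
  case (1 c)
  then have a': "Suc a = 4 * c + 1" by simp
  show ?thesis
  proof (cases "c = 0")
    case True
    then show ?thesis using 1 assms(1-4) by (simp add: level_start)
  next
    case False
    then have "\<phi> = 0" using assms(7) 1 by (simp add: gate_simps)
    then show ?thesis unfolding a' unfolding 1 level_simps
      by (intro max_0_lipschitz) (use assms(3,5) in linarith)
  qed
next
  case (2 c)
  then have a': "Suc a = 4 * c + 2" by simp
  then have "\<psi> = L" using assms(8) gate_simps(2) by simp
  then show ?thesis unfolding a' unfolding 2 level_simps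
    by (intro max_0_lipschitz) (use assms(2,5) in linarith)
next
  case (3 c)
  then have a': "Suc a = 4 * c + 3" by simp
  have "\<phi> = L" using assms(6) 3 gate_simps(2) by simp
  then show ?thesis unfolding a' unfolding 3 level_simps
    by (intro max_0_lipschitz) (use assms(4,5) in linarith)
next
  case (4 c)
  then have a': "Suc a = 4 * Suc c" by simp
  then have "\<psi> = 0" using assms(9) gate_simps(1)[of "Suc c"] by simp
  then show ?thesis unfolding a' unfolding 4 level_simps
    by (intro max_0_lipschitz) (use assms(1,5) in \<open>simp add: algebra_simps\<close>)
qed

lemma level_lipschitz:
  assumes "0 \<le> \<phi>" "\<phi> \<le> L" "0 \<le> \<psi>" "\<psi> \<le> L" "\<bar>\<phi> - \<psi>\<bar> \<le> 1" "a \<le> Suc b" "b \<le> Suc a"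
    and "gate True a \<Longrightarrow> \<phi> = L" "gate False a \<Longrightarrow> \<phi> = 0"
    and "gate True b \<Longrightarrow> \<psi> = L" "gate False b \<Longrightarrow> \<psi> = 0"
  shows "\<bar>level L a \<phi> - level L b \<psi>\<bar> \<le> 1"
proof -
  consider "a = b" | "b = Suc a" | "a = Suc b" using assms(6,7) by linarith
  then show ?thesis
  proof cases
    case 1
    then show ?thesis unfolding level_def by (intro max_0_lipschitz) (use assms(5) in \<open>simp add: abs_minus_commute\<close>)
  next
    case 2
    then show ?thesis using level_lipschitz_Suc[of \<phi> L \<psi> a] assms by simp
  next
    case 3
    then show ?thesis using level_lipschitz_Suc[of \<psi> L \<phi> b] assms by (simp add: abs_minus_commute)
  qed
qed

section \<open>The graph with parameters \<open>k\<close>, \<open>M\<close> and \<open>e\<close>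
  padding leaves\<close>

locale chase =
  fixes k M e :: nat
  assumes k: "2 \<le> k" and M: "1 \<le> M"
begin

text \<open>
  The ring vertices up to \<open>len - 4\<close> form the lowest digit of the odometer.  The last three, which
  also close the ring, are the only ones adjacent to the vault, a site controlled only while the last
  cop is at the beginning of her track: through them the robber enters the ring.
\<close>

definition len :: nat where "len = 3 * M + 3"
text \<open>Of the form \<open>4 * c + 2\<close>: the end of a track is itself an upper gate, where
  the digit reads \<open>2 * M\<close> times the range of the digit below.\<close>

definition top :: nat where "top = 4 * M + 2"
text \<open>Each of at most \<open>k\<close> cops blocks at most two of the points of a haven within
  reach, one for each \<open>x < d\<close>; so one stays free.\<close>

definition d :: nat where "d = 2 * k + 1"
definition q :: nat where "q = (d * (4 + 3 * k))\<^sup>2"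

abbreviation corner :: "bool \<Rightarrow> nat" where "corner b \<equiv> (if b then top else 0)"
abbreviation ring_corner :: "bool \<Rightarrow> nat" where "ring_corner b \<equiv> (if b then len - 4 else 0)"

fun site_ok :: "site \<Rightarrow> bool" where
  "site_ok (Ring w) \<longleftrightarrow> w < len"
| "site_ok (Haven i) \<longleftrightarrow> i < k"
| "site_ok Vault \<longleftrightarrow> True"
| "site_ok (Alarm i b) \<longleftrightarrow> i < k"

fun vert_ok :: "vert \<Rightarrow> bool" where
  "vert_ok (Cop t a f) \<longleftrightarrow> t < k \<and> a \<le> top \<and> f < 3"
| "vert_ok (Rob s x y) \<longleftrightarrow> site_ok s \<and> x < d \<and> y < q"
| "vert_ok Hub \<longleftrightarrow> True"
| "vert_ok (Leaf i) \<longleftrightarrow> i < e"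

text \<open>An alarm is open exactly if its own cop stands on the gate and the previous cop is not
  at the matching corner. For \<open>i = 0\<close> the digit below is the robber himself, and the
  condition is moved into \<open>near\<close>. The clause for \<open>top\<close> is what finally
  loses the ring.\<close>

fun guards :: "nat \<Rightarrow> nat \<Rightarrow> nat \<Rightarrow> site \<Rightarrow> bool" where
  "guards t a f (Ring w) \<longleftrightarrow> t = 0 \<and> w mod 3 \<noteq> f \<or> t = k - 1 \<and> a = top"
| "guards t a f (Haven i) \<longleftrightarrow> t = i"
| "guards t a f Vault \<longleftrightarrow> t = k - 1 \<and> a = 0"
| "guards t a f (Alarm i b) \<longleftrightarrow> t = i \<and> \<not> gate b a \<or> Suc t = i \<and> a = corner b"

fun near :: "site \<Rightarrow> site \<Rightarrow> bool" where
  "near (Ring v) (Ring w) \<longleftrightarrow> v = w \<or> w = Suc v mod len \<or> v = Suc w mod len"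
| "near (Ring w) Vault \<longleftrightarrow> len - 3 \<le> w"
| "near Vault (Ring w) \<longleftrightarrow> len - 3 \<le> w"
| "near (Ring w) (Alarm i b) \<longleftrightarrow> (i = 0 \<longrightarrow> w \<noteq> ring_corner b)"
| "near (Alarm i b) (Ring w) \<longleftrightarrow> (i = 0 \<longrightarrow> w \<noteq> ring_corner b)"
| "near _ _ \<longleftrightarrow> True"

text \<open>Ring vertices share classes by residue, so the number of labels, and with it the blow-up
  factor \<open>d * q\<close>, does not depend on \<open>M\<close>.\<close>

fun cls :: "site \<Rightarrow> nat" where
  "cls (Ring w) = w mod 3"
| "cls Vault = 3"
| "cls (Haven i) = 4 + i"
| "cls (Alarm i b) = 4 + k + 2 * i + (if b then 1 else 0)"

definition lab :: "site \<Rightarrow> nat \<Rightarrow> nat" where "lab s x = d * cls s + x"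

fun adj :: "vert \<Rightarrow> vert \<Rightarrow> bool" where
  "adj (Cop t a f) (Cop t' a' f') \<longleftrightarrow> t = t' \<and> a \<le> Suc a' \<and> a' \<le> Suc a"
| "adj (Cop t a f) (Rob s x y) \<longleftrightarrow> guards t a f s"
| "adj (Rob s x y) (Cop t a f) \<longleftrightarrow> guards t a f s"
| "adj (Rob s x y) (Rob s' x' y') \<longleftrightarrow> near s s' \<and> (y + y') mod q = (lab s x * lab s' x') mod q"
| "adj Hub (Cop t a f) \<longleftrightarrow> True"
| "adj (Cop t a f) Hub \<longleftrightarrow> True"
| "adj Hub (Rob s x y) \<longleftrightarrow> (\<forall>i. s \<noteq> Haven i)"
| "adj (Rob s x y) Hub \<longleftrightarrow> (\<forall>i. s \<noteq> Haven i)"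
| "adj Hub (Leaf i) \<longleftrightarrow> True"
| "adj (Leaf i) Hub \<longleftrightarrow> True"
| "adj _ _ \<longleftrightarrow> False"

definition G :: "vert pair_pre_digraph" where
  "G = \<lparr>pverts = {u. vert_ok u}, parcs = {(u, v). vert_ok u \<and> vert_ok v \<and> u \<noteq> v \<and> adj u v}\<rparr>"

section \<open>Size and symmetry of the graph\<close>

lemma pverts_G [simp]: "u \<in> pverts G \<longleftrightarrow> vert_ok u"
  by (simp add: G_def)

lemma legal_G: "legal_move G u v \<longleftrightarrow> vert_ok u \<and> vert_ok v \<and> (u = v \<or> adj u v)"
  by (auto simp: legal_move_def G_def)

lemma adj_sym: "adj u v \<Longrightarrow> adj v u"
proof (induction u v rule: adj.induct)
  case (4 s x y s' x' y')
  moreover have "near s s' \<Longrightarrow> near s' s"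
    by (induction s s' rule: near.induct) auto
  ultimately show ?case by (simp add: add.commute mult.commute)
qed auto

definition sites :: "site set" where
  "sites = Ring ` {..<len} \<union> Haven ` {..<k} \<union> {Vault} \<union> (\<lambda>(i, b). Alarm i b) ` ({..<k} \<times> UNIV)"

lemma site_ok_iff: "site_ok s \<longleftrightarrow> s \<in> sites"
  by (cases s) (auto simp: sites_def)

lemma finite_sites: "finite sites"
  by (simp add: sites_def)

lemma card_sites: "card sites = len + 3 * k + 1"
proof -
  have "card (Ring ` {..<len}) = len" "card (Haven ` {..<k}) = k"
    by (simp_all add: card_image inj_on_def)
  moreover have "card ((\<lambda>(i, b). Alarm i b) ` ({..<k} \<times> (UNIV :: bool set))) = 2 * k"
    by (subst card_image) (auto simp: inj_on_def card_cartesian_product)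
  moreover have "card sites = card (Ring ` {..<len}) + card (Haven ` {..<k}) + card {Vault}
      + card ((\<lambda>(i, b). Alarm i b) ` ({..<k} \<times> (UNIV :: bool set)))"
    unfolding sites_def
    by (subst card_Un_disjoint, simp, simp, force)+ simp
  ultimately show ?thesis by simp
qed

lemma pverts_eq: "pverts G = (\<lambda>(t, a, f). Cop t a f) ` ({..<k} \<times> {..top} \<times> {..<3})
    \<union> (\<lambda>(s, x, y). Rob s x y) ` (sites \<times> {..<d} \<times> {..<q}) \<union> {Hub} \<union> Leaf ` {..<e}"
    (is "_ = ?R")
proof (rule set_eqI)
  fix u
  show "u \<in> pverts G \<longleftrightarrow> u \<in> ?R"
    by (cases u) (auto simp: site_ok_iff image_iff)
qed

lemma finite_pverts_G: "finite (pverts G)"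
  by (simp add: pverts_eq finite_sites)

lemma card_pverts_G: "card (pverts G) = 3 * k * (top + 1) + (len + 3 * k + 1) * (d * q) + 1 + e"
proof -
  let ?C = "(\<lambda>(t, a, f). Cop t a f) ` ({..<k} \<times> {..top} \<times> {..<3 :: nat})"
  let ?R = "(\<lambda>(s, x, y). Rob s x y) ` (sites \<times> {..<d} \<times> {..<q})"
  have "card ?C = 3 * k * (top + 1)"
    by (subst card_image) (auto simp: inj_on_def card_cartesian_product algebra_simps)
  moreover have "card ?R = (len + 3 * k + 1) * (d * q)"
    by (subst card_image) (auto simp: inj_on_def card_cartesian_product card_sites)
  moreover have "card (Leaf ` {..<e}) = e"
    by (simp add: card_image inj_on_def)
  moreover have "card (pverts G) = card ?C + card ?R + card {Hub} + card (Leaf ` {..<e})"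
    unfolding pverts_eq
    by (subst card_Un_disjoint, simp add: finite_sites, simp add: finite_sites, force)+ simp
  ultimately show ?thesis by simp
qed

lemma pair_graph_G: "pair_graph G"
proof
  show "finite (pverts G)" by (rule finite_pverts_G)
  have "parcs G \<subseteq> pverts G \<times> pverts G" by (auto simp: G_def)
  then show "finite (parcs G)"
    by (rule finite_subset) (intro finite_cartesian_product finite_pverts_G)
  show "symmetric (with_proj G)"
    unfolding symmetric_def with_proj_simps
    by (rule symI) (auto simp: G_def intro: adj_sym)
qed (auto simp: G_def)

section \<open>Labels and common neighbours in the blow-up\<close>

lemma pos: "0 < d" "0 < q" "4 \<le> len" "len mod 3 = 0"
proof -
  show "0 < d" by (simp add: d_def)
  then show "0 < q" by (simp add: q_def)
  show "4 \<le> len" using M by (simp add: len_def)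
  show "len mod 3 = 0" unfolding len_def by presburger
qed

lemma cls_less: "site_ok s \<Longrightarrow> cls s < 4 + 3 * k"
  by (cases s) auto

lemma cls_eqD:
  assumes "site_ok s" "site_ok s'" "cls s = cls s'" "\<And>w. s \<noteq> Ring w"
  shows "s = s'"
proof (cases s)
  case (Alarm i b)
  then show ?thesis using assms by (cases s') (auto split: if_splits, presburger+)
qed (use assms in \<open>(cases s', auto split: if_splits)+\<close>)

lemma lab_eqD:
  assumes "lab s x = lab s' x'" "x < d" "x' < d"
  shows "cls s = cls s'" "x = x'"
proof -
  have "lab s x div d = cls s" "lab s' x' div d = cls s'" "lab s x mod d = x" "lab s' x' mod d = x'"
    using assms(2,3) by (simp_all add: lab_def)
  then show "cls s = cls s'" "x = x'" using assms(1) by metis+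
qed

lemma lab_less:
  assumes "site_ok s" "x < d"
  shows "lab s x < d * (4 + 3 * k)"
proof -
  have "lab s x < d * cls s + d" using assms by (simp add: lab_def)
  also have "\<dots> = d * Suc (cls s)" by simp
  also have "\<dots> \<le> d * (4 + 3 * k)" using cls_less[OF assms(1)] by (intro mult_le_mono2) simp
  finally show ?thesis .
qed

lemma partner_exists:
  assumes "y < q"
  obtains y' where "y' < q" "(y + y') mod q = c mod q"
proof
  show "(c + (q - y)) mod q < q" using pos by simp
  have "(y + (c + (q - y)) mod q) mod q = (y + (c + (q - y))) mod q" by (rule mod_add_right_eq)
  also have "y + (c + (q - y)) = c + q" using assms by simp
  finally show "(y + (c + (q - y)) mod q) mod q = c mod q" by simp
qed

text \<open>On arrival at a near site the robber chooses \<open>x'\<close> freely; the congruence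
  then fixes \<open>y'\<close>.\<close>

lemma rob_neighbour:
  assumes "vert_ok (Rob s x y)" "site_ok s'" "near s s'" "x' < d"
  obtains y' where "vert_ok (Rob s' x' y')" "legal_move G (Rob s x y) (Rob s' x' y')"
  using partner_exists[of y "lab s x * lab s' x'"] assms by (auto simp: legal_G)

text \<open>A common neighbour of two points with different labels is determined by its label, since
  \<^term>\<open>q\<close> is at least the square of the number of labels.\<close>

lemma common_neighbour_unique:
  assumes ok: "site_ok s1" "x1 < d" "y1 < q" "site_ok s2" "x2 < d" "y2 < q"
      "site_ok s" "x < d" "x' < d"
    and ne: "\<not> (cls s1 = cls s2 \<and> x1 = x2 \<and> y1 = y2)"
    and "(y1 + y) mod q = (lab s1 x1 * lab s x) mod q" "(y2 + y) mod q = (lab s2 x2 * lab s x) mod q"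
    and "(y1 + y') mod q = (lab s1 x1 * lab s x') mod q" "(y2 + y') mod q = (lab s2 x2 * lab s x') mod q"
  shows "x = x'"
proof (rule ccontr)
  assume "x \<noteq> x'"
  define a1 a2 b b' where defs: "a1 = int (lab s1 x1)" "a2 = int (lab s2 x2)" "b = int (lab s x)" "b' = int (lab s x')"
  define N where "N = int (d * (4 + 3 * k))"
  have q: "int q = N * N" by (simp add: q_def N_def power2_eq_square)
  have dvd: "int q dvd (int y1 + int y) - a1 * b" "int q dvd (int y2 + int y) - a2 * b"
      "int q dvd (int y1 + int y') - a1 * b'" "int q dvd (int y2 + int y') - a2 * b'"
    using assms(11-14) unfolding defs mod_eq_dvd_iff[symmetric]
    by (metis of_nat_add of_nat_mult of_nat_mod)+
  \<comment> \<open>Eliminating \<open>y1\<close>, \<open>y2\<close>, \<open>y\<close> and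
    \<open>y'\<close> from the four congruences leaves that \<open>q\<close> divides
    \<open>(a1 - a2) * (b - b')\<close>.\<close>
  have "int q dvd ((int y1 + int y) - a1 * b) - ((int y2 + int y) - a2 * b)"
    by (rule dvd_diff[OF dvd(1,2)])
  then have 1: "int q dvd (int y1 - int y2) - (a1 - a2) * b" by (simp add: algebra_simps)
  have "int q dvd ((int y1 + int y') - a1 * b') - ((int y2 + int y') - a2 * b')"
    by (rule dvd_diff[OF dvd(3,4)])
  then have 2: "int q dvd (int y1 - int y2) - (a1 - a2) * b'" by (simp add: algebra_simps)
  from dvd_diff[OF 2 1] have 3: "int q dvd (a1 - a2) * (b - b')" by (simp add: algebra_simps)
  have "\<bar>a1 - a2\<bar> < N" "\<bar>b - b'\<bar> < N"
    using lab_less[of s1 x1] lab_less[of s2 x2] lab_less[of s x] lab_less[of s x'] ok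
    unfolding defs N_def by linarith+
  then have "\<bar>(a1 - a2) * (b - b')\<bar> < N * N"
    unfolding abs_mult by (intro mult_strict_mono') auto
  then have "(a1 - a2) * (b - b') = 0"
    using dvd_imp_le_int[OF _ 3] q by (metis abs_of_nat linorder_not_le)
  moreover have "b \<noteq> b'" using \<open>x \<noteq> x'\<close> by (simp add: defs lab_def)
  ultimately have "a1 = a2" by simp
  then have "lab s1 x1 = lab s2 x2" by (simp add: defs)
  from lab_eqD[OF this ok(2,5)] have "cls s1 = cls s2" "x1 = x2" by blast+
  moreover have "y1 = y2"
  proof -
    have dvd: "int q dvd int y1 - int y2" using 1 \<open>a1 = a2\<close> by simp
    have "\<bar>int y1 - int y2\<bar> < int q" using ok by linarith
    then have "int y1 - int y2 = 0"
      using dvd_imp_le_int[OF _ dvd] by (metis abs_of_nat linorder_not_le)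
    then show ?thesis by simp
  qed
  ultimately show False using ne by blast
qed


section \<open>Safe replies from points off the tracks\<close>

definition safe :: "nat \<Rightarrow> (nat \<Rightarrow> vert) \<Rightarrow> vert \<Rightarrow> bool" where
  "safe j P r \<longleftrightarrow> (\<forall>i<j. \<not> legal_move G (P i) r)"

text \<open>An equality of images, because no cop is tied to a particular track; with at most
  \<open>k\<close> cops it forces exactly one cop on each.\<close>

definition config :: "nat \<Rightarrow> (nat \<Rightarrow> vert) \<Rightarrow> (nat \<Rightarrow> nat) \<Rightarrow> (nat \<Rightarrow> nat) \<Rightarrow> bool" where
  "config j P A F \<longleftrightarrow> P ` {..<j} = (\<lambda>t. Cop t (A t) (F t)) ` {..<k}"

text \<open>The robber reaches one point of the haven for each of the \<open>d\<close> values of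
  \<open>x'\<close>. A cop blocks at most one by standing on it and at most one by adjacency; the
  latter is \<open>common_neighbour_unique\<close>, for which \<open>diff\<close> excludes a cop on
  a twin of the robber's point.\<close>

lemma escape_to_haven:
  assumes j: "j \<le> k" and P: "\<forall>i<j. vert_ok (P i)" and r: "vert_ok (Rob s x y)"
    and t: "t < k" and missing: "\<forall>i<j. \<forall>a f. P i \<noteq> Cop t a f"
    and diff: "\<forall>i<j. \<forall>s'. P i = Rob s' x y \<longrightarrow> cls s' \<noteq> cls s"
  shows "\<exists>x' y'. legal_move G (Rob s x y) (Rob (Haven t) x' y') \<and> safe j P (Rob (Haven t) x' y')"
proof -
  have near: "near s' (Haven t)" for s' by (cases s') auto
  have "\<forall>x'. \<exists>y'. y' < q \<and> (y + y') mod q = (lab s x * lab (Haven t) x') mod q"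
    using partner_exists[of y] r by (metis vert_ok.simps(2))
  from choice[OF this] obtain Y where Y: "\<And>x'. Y x' < q"
      "\<And>x'. (y + Y x') mod q = (lab s x * lab (Haven t) x') mod q"
    by blast
  define R where "R x' = Rob (Haven t) x' (Y x')" for x'
  have R: "legal_move G (Rob s x y) (R x')" if "x' < d" for x'
    using that r t Y near by (simp add: R_def legal_G)
  define bad where "bad i = {x'. x' < d \<and> legal_move G (P i) (R x')}" for i
  have "card (bad i) \<le> 2" if i: "i < j" for i
  proof -
    define B1 where "B1 = {x'. x' < d \<and> P i = R x'}"
    define B2 where "B2 = {x'. x' < d \<and> adj (P i) (R x')}"
    have fin: "finite B1" "finite B2" by (simp_all add: B1_def B2_def)
    have "card B1 \<le> Suc 0" unfolding card_le_Suc0_iff_eq[OF fin(1)] by (auto simp: B1_def R_def)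
    moreover have "card B2 \<le> Suc 0" unfolding card_le_Suc0_iff_eq[OF fin(2)]
    proof (intro ballI)
      fix u v assume "u \<in> B2" "v \<in> B2"
      then have uv: "u < d" "v < d" "adj (P i) (R u)" "adj (P i) (R v)" by (auto simp: B2_def)
      show "u = v"
      proof (cases "P i")
        case (Rob s2 x2 y2)
        have ok2: "site_ok s2" "x2 < d" "y2 < q" using P i Rob by fastforce+
        have "\<not> (cls s = cls s2 \<and> x = x2 \<and> y = y2)" using diff i Rob by auto
        moreover have "(y2 + Y u) mod q = (lab s2 x2 * lab (Haven t) u) mod q"
            "(y2 + Y v) mod q = (lab s2 x2 * lab (Haven t) v) mod q"
          using uv Rob by (simp_all add: R_def)
        ultimately show ?thesis
          using common_neighbour_unique[of s x y s2 x2 y2 "Haven t" u v "Y u" "Y v"] r ok2 uv t Y(2)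
          by simp
      \<comment> \<open>Cops on other tracks guard only their own havens; hub and leaves are
        adjacent to none.\<close>
      qed (use uv missing i in \<open>auto simp: R_def\<close>)
    qed
    moreover have "bad i \<subseteq> B1 \<union> B2" by (auto simp: bad_def B1_def B2_def legal_G)
    ultimately show ?thesis
      using card_mono[of "B1 \<union> B2" "bad i"] card_Un_le[of B1 B2] fin by simp
  qed
  then have "(\<Sum>i<j. card (bad i)) \<le> (\<Sum>i<j. 2)" by (intro sum_mono) simp
  moreover have "card (\<Union>i<j. bad i) \<le> (\<Sum>i<j. card (bad i))" by (intro card_UN_le) simp
  ultimately have "card (\<Union>i<j. bad i) < card {..<d}" using j by (simp add: d_def)
  moreover have "finite (\<Union>i<j. bad i)" by (simp add: bad_def)
  ultimately have "\<not> {..<d} \<subseteq> (\<Union>i<j. bad i)"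
    using card_mono[of "\<Union>i<j. bad i" "{..<d}"] by linarith
  then obtain x' where x': "x' \<in> {..<d}" "x' \<notin> (\<Union>i<j. bad i)"
    unfolding subset_iff by metis
  then have "\<not> legal_move G (P i) (R x')" if "i < j" for i
    using that unfolding bad_def by blast
  then have "legal_move G (Rob s x y) (R x') \<and> safe j P (R x')"
    using R x'(1) unfolding safe_def by blast
  then show ?thesis unfolding R_def by blast
qed

text \<open>Pigeonhole: at most \<open>k\<close> cops occupying all \<open>k\<close> tracks leave
  none to spare elsewhere.\<close>

lemma config_cases:
  assumes "j \<le> k" "\<forall>i<j. vert_ok (P i)"
  obtains t where "t < k" "\<forall>i<j. \<forall>a f. P i \<noteq> Cop t a f"
  | A F where "config j P A F" "\<forall>t<k. A t \<le> top" "\<forall>t<k. F t < 3"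
proof (cases "\<exists>t<k. \<forall>i<j. \<forall>a f. P i \<noteq> Cop t a f")
  case True
  then show thesis using that(1) by blast
next
  case False
  then have "\<forall>t. \<exists>a f. t < k \<longrightarrow> Cop t a f \<in> P ` {..<j}"
    by (metis imageI lessThan_iff)
  then obtain A F where AF: "\<And>t. t < k \<Longrightarrow> Cop t (A t) (F t) \<in> P ` {..<j}"
    by metis
  let ?C = "(\<lambda>t. Cop t (A t) (F t)) ` {..<k}"
  have "card ?C = k" by (subst card_image) (auto intro: inj_onI)
  moreover have "card (P ` {..<j}) \<le> j" using card_image_le[of "{..<j}" P] by simp
  ultimately have "?C = P ` {..<j}" using AF assms(1) by (intro card_seteq) auto
  then have "config j P A F" by (simp add: config_def)
  moreover have "vert_ok (Cop t (A t) (F t))" if "t < k" for t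
    using AF[OF that] assms(2) by (metis imageE lessThan_iff)
  ultimately show thesis using that(2) by (simp del: lessThan_iff)
qed

lemma config_card: "config j P A F \<Longrightarrow> k \<le> j"
proof -
  assume "config j P A F"
  then have "card ((\<lambda>t. Cop t (A t) (F t)) ` {..<k}) \<le> card {..<j}"
    unfolding config_def by (metis card_image_le finite_lessThan)
  moreover have "card ((\<lambda>t. Cop t (A t) (F t)) ` {..<k}) = k"
    by (subst card_image) (auto intro: inj_onI)
  ultimately show ?thesis by simp
qed

lemma config_Cop: "config j P A F \<Longrightarrow> i < j \<Longrightarrow> \<exists>t<k. P i = Cop t (A t) (F t)"
  unfolding config_def by (metis imageE imageI lessThan_iff)

lemma config_obtain: "config j P A F \<Longrightarrow> t < k \<Longrightarrow> \<exists>i<j. P i = Cop t (A t) (F t)"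
proof -
  assume "config j P A F" "t < k"
  then have "Cop t (A t) (F t) \<in> P ` {..<j}" unfolding config_def by blast
  then show ?thesis by auto
qed

lemma safe_config:
  assumes "config j P A F" "\<And>t. t < k \<Longrightarrow> \<not> guards t (A t) (F t) s"
  shows "safe j P (Rob s x y)"
  unfolding safe_def using assms(2) config_Cop[OF assms(1)] by (fastforce simp: legal_G)

text \<open>With a track deserted, its haven is free. Otherwise the vault is free unless the last
  cop is at \<open>0\<close>, and precisely then the robber enters the ring, at the residue left
  open by the phase.\<close>

lemma respond_in_haven:
  assumes j: "j \<le> k" and P: "\<forall>i<j. vert_ok (P i)" and r: "vert_ok (Rob s x y)"
    and s: "\<And>w. s \<noteq> Ring w" and free: "\<forall>i<j. P i \<noteq> Rob s x y"
  shows "\<exists>s' x' y'. legal_move G (Rob s x y) (Rob s' x' y') \<and> safe j P (Rob s' x' y') \<and>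
    ((\<forall>w. s' \<noteq> Ring w) \<or> (\<exists>A F w. s' = Ring w \<and> config j P A F \<and> A (k - 1) = 0 \<and> F 0 = w mod 3))"
proof (rule config_cases[OF j P])
  fix t assume t: "t < k" "\<forall>i<j. \<forall>a f. P i \<noteq> Cop t a f"
  \<comment> \<open>Off the ring the class determines the site, so a twin of the robber's point
    would be that point itself.\<close>
  have "\<forall>i<j. \<forall>s'. P i = Rob s' x y \<longrightarrow> cls s' \<noteq> cls s"
  proof (intro allI impI notI)
    fix i s' assume "i < j" "P i = Rob s' x y" "cls s' = cls s"
    moreover from this have "site_ok s'" using P by fastforce
    ultimately show False using cls_eqD[of s s'] r s free by auto
  qed
  from escape_to_haven[OF j P r t this] show ?thesis by blast
next
  fix A F assume c: "config j P A F" and AF: "\<forall>t<k. A t \<le> top" "\<forall>t<k. F t < 3"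
  show ?thesis
  proof (cases "A (k - 1) = 0")
    case False
    have "near s Vault" using s by (cases s) auto
    then obtain y' where "vert_ok (Rob Vault 0 y')" "legal_move G (Rob s x y) (Rob Vault 0 y')"
      using rob_neighbour[OF r, of Vault 0] pos by auto
    moreover have "safe j P (Rob Vault 0 y')"
      by (rule safe_config[OF c]) (use False in auto)
    ultimately show ?thesis by blast
  next
    case True
    \<comment> \<open>As \<open>len\<close> is a multiple of 3, this vertex has residue
      \<open>F 0\<close>; it lies among the last three, hence next to the vault, and is neither ring
      corner, hence next to all alarms.\<close>
    define w where "w = len - 3 + F 0"
    have F0: "F 0 < 3" using AF k by simp
    have w: "w mod 3 = F 0" "w < len" "len - 3 \<le> w" "w \<noteq> len - 4" "w \<noteq> 0"
      using F0 pos M unfolding w_def len_def by auto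
    then have "near s (Ring w)" using s by (cases s) auto
    then obtain y' where "vert_ok (Rob (Ring w) 0 y')" "legal_move G (Rob s x y) (Rob (Ring w) 0 y')"
      using rob_neighbour[OF r, of "Ring w" 0] pos w by auto
    moreover have "safe j P (Rob (Ring w) 0 y')"
    proof (rule safe_config[OF c])
      show "\<not> guards t (A t) (F t) (Ring w)" for t
        using True w by (cases "t = 0") (auto simp: top_def)
    qed
    ultimately show ?thesis using c True w by metis
  qed
qed


section \<open>The strategy of the robber\<close>

text \<open>Expresses that no alarm of digit \<open>t\<close> is open to a robber at
  \<open>Ring w\<close>.\<close>

definition consistent :: "nat \<Rightarrow> (nat \<Rightarrow> nat) \<Rightarrow> nat \<Rightarrow> bool" where
  "consistent t A w \<longleftrightarrow>
     (\<forall>b. gate b (A t) \<longrightarrow> (if t = 0 then w = ring_corner b else A (t - 1) = corner b))"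

definition lawful :: "(nat \<Rightarrow> nat) \<Rightarrow> nat \<Rightarrow> bool" where
  "lawful A w \<longleftrightarrow> (\<forall>t<k. consistent t A w)"

fun span :: "nat \<Rightarrow> int" where
  "span 0 = int (len - 4)"
| "span (Suc t) = 2 * int M * span t"

text \<open>The odometer reading of the ring and the lowest \<open>t\<close> tracks;
  \<open>span t\<close> is its largest value.\<close>

fun pot :: "(nat \<Rightarrow> nat) \<Rightarrow> nat \<Rightarrow> nat \<Rightarrow> int" where
  "pot A w 0 = int w"
| "pot A w (Suc t) = level (span t) (A t) (pot A w t)"

lemma span_eq: "span t = int ((2 * M) ^ t * (len - 4))"
  by (induction t) auto

lemma span_nonneg: "0 \<le> span t"
  by (simp add: span_eq)

lemma pot_range:
  assumes "w \<le> len - 4" "\<And>i. i < t \<Longrightarrow> A i \<le> top"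
  shows "0 \<le> pot A w t \<and> pot A w t \<le> span t"
  using assms(2)
proof (induction t)
  case 0
  then show ?case using assms(1) by simp
next
  case (Suc t)
  then show ?case using level_le[of "pot A w t" "span t" "A t" M] level_nonneg by (simp add: top_def)
qed

text \<open>At both ends of a track \<open>level\<close> is constant in the value below, so the
  corner of one digit fixes the reading regardless of the digits beneath it.\<close>

lemma pot_corner:
  assumes "t < k" "consistent t A w" "gate b (A t)" "w \<le> len - 4" "\<And>i. i < k \<Longrightarrow> A i \<le> top"
  shows "pot A w t = (if b then span t else 0)"
proof (cases t)
  case 0
  then show ?thesis using assms by (auto simp: consistent_def)
next
  case (Suc t')
  then have "A t' = corner b" using assms by (auto simp: consistent_def)
  moreover have "pot A w t' \<le> span t'" using pot_range[of w t' A] assms Suc by simp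
  ultimately show ?thesis
    using Suc level_end[OF span_nonneg, of t' M] level_start[OF _ span_nonneg, of _ t' 0]
    by (auto simp: top_def)
qed

text \<open>Induction over the digits: lawfulness before and after the round supplies the pinned
  values that \<open>level_lipschitz\<close> requires at gates.\<close>

lemma pot_lipschitz:
  assumes "lawful A v" "lawful B w" "v \<le> len - 4" "w \<le> len - 4" "v \<le> Suc w" "w \<le> Suc v"
    and le: "\<And>t. t < k \<Longrightarrow> A t \<le> top" "\<And>t. t < k \<Longrightarrow> B t \<le> top"
    and AB: "\<And>t. t < k \<Longrightarrow> A t \<le> Suc (B t)" "\<And>t. t < k \<Longrightarrow> B t \<le> Suc (A t)"
  shows "t \<le> k \<Longrightarrow> \<bar>pot A v t - pot B w t\<bar> \<le> 1"
proof (induction t)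
  case 0
  then show ?case using assms by auto
next
  case (Suc t)
  then have t: "t < k" by simp
  have cons: "consistent t A v" "consistent t B w" using assms t by (auto simp: lawful_def)
  show ?case unfolding pot.simps
  proof (rule level_lipschitz)
    show "0 \<le> pot A v t" "pot A v t \<le> span t" "0 \<le> pot B w t" "pot B w t \<le> span t"
      using pot_range[of v t A] pot_range[of w t B] assms t by auto
  qed (use Suc t AB pot_corner[OF t cons(1)] pot_corner[OF t cons(2)] assms in auto)
qed

text \<open>
  Here \<open>v\<close> is the ring vertex that the robber occupied one round ago.  The potential is measured at
  \<open>v\<close> because the alarm vertices at hand have been adjacent to \<open>v\<close>, so \<open>v\<close> rather than \<open>w\<close> is
  consistent with the current positions of the cops.
\<close>

definition good :: "nat \<Rightarrow> (nat \<Rightarrow> vert) \<Rightarrow> vert \<Rightarrow> nat \<Rightarrow> bool" where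
  "good j P r c \<longleftrightarrow> (\<exists>s x y. r = Rob s x y \<and> vert_ok r \<and> safe j P r \<and>
     (\<forall>w. s = Ring w \<longrightarrow> (\<exists>A F. config j P A F \<and> F 0 = w mod 3 \<and> A (k - 1) \<noteq> top \<and>
       (A (k - 1) = 0 \<or> len - 3 \<le> w \<or>
         (\<exists>v\<le>len - 4. v \<le> Suc w \<and> w \<le> Suc v \<and> lawful A v \<and> pot A v k \<le> int c)))))"

lemma goodI_haven:
  "vert_ok (Rob s x y) \<Longrightarrow> safe j P (Rob s x y) \<Longrightarrow> (\<And>w. s \<noteq> Ring w) \<Longrightarrow> good j P (Rob s x y) c"
  by (auto simp: good_def)

lemma goodI_ring:
  assumes "vert_ok (Rob (Ring w) x y)" "safe j P (Rob (Ring w) x y)"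
    and "config j P A F" "F 0 = w mod 3" "A (k - 1) \<noteq> top"
    and "A (k - 1) = 0 \<or> len - 3 \<le> w \<or>
      (\<exists>v\<le>len - 4. v \<le> Suc w \<and> w \<le> Suc v \<and> lawful A v \<and> pot A v k \<le> int c)"
  shows "good j P (Rob (Ring w) x y) c"
proof -
  have "\<forall>w'. Ring w = Ring w' \<longrightarrow> (\<exists>A F. config j P A F \<and> F 0 = w' mod 3 \<and> A (k - 1) \<noteq> top \<and>
       (A (k - 1) = 0 \<or> len - 3 \<le> w' \<or>
         (\<exists>v\<le>len - 4. v \<le> Suc w' \<and> w' \<le> Suc v \<and> lawful A v \<and> pot A v k \<le> int c)))"
    unfolding site.inject using assms(3-6) by blast
  then show ?thesis unfolding good_def using assms(1,2) by blast
qed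

text \<open>The last clause prepares the case of too few cops: they never form a
  \<open>config\<close>, so the ring is not entered.\<close>

lemma good_start:
  assumes j: "j \<le> k" and P: "\<forall>i<j. vert_ok (P i)" and r: "vert_ok (Rob s x y)"
    and s: "\<And>w. s \<noteq> Ring w" and free: "\<forall>i<j. P i \<noteq> Rob s x y"
  shows "\<exists>r'. legal_move G (Rob s x y) r' \<and> good j P r' c \<and> (j < k \<longrightarrow> (\<forall>w x y. r' \<noteq> Rob (Ring w) x y))"
proof -
  obtain s' x' y' where r': "legal_move G (Rob s x y) (Rob s' x' y')" "safe j P (Rob s' x' y')"
    and alt: "(\<forall>w. s' \<noteq> Ring w) \<or>
      (\<exists>A F w. s' = Ring w \<and> config j P A F \<and> A (k - 1) = 0 \<and> F 0 = w mod 3)"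
    using respond_in_haven[OF assms] by blast
  have ok: "vert_ok (Rob s' x' y')" using r'(1) by (simp add: legal_G)
  have "top \<noteq> 0" by (simp add: top_def)
  have "good j P (Rob s' x' y') c"
  proof (cases "\<exists>w. s' = Ring w")
    case False
    then show ?thesis using goodI_haven ok r'(2) by blast
  next
    case True
    then obtain A F w where "s' = Ring w" "config j P A F" "A (k - 1) = 0" "F 0 = w mod 3"
      using alt by blast
    then show ?thesis using goodI_ring[of w x' y' j P A F c] ok r'(2) \<open>top \<noteq> 0\<close> by simp
  qed
  moreover have "j < k \<longrightarrow> (\<forall>w x y. Rob s' x' y' \<noteq> Rob (Ring w) x y)"
  proof
    assume "j < k"
    then have "\<not> config j P A F" for A F using config_card leD by blast
    then have "\<forall>w. s' \<noteq> Ring w" using alt by blast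
    then show "\<forall>w x y. Rob s' x' y' \<noteq> Rob (Ring w) x y" unfolding vert.inject by blast
  qed
  ultimately show ?thesis using r'(1) by blast
qed

section \<open>One round on the ring\<close>

lemma mod3_Suc: "Suc w mod len mod 3 = Suc w mod 3"
  by (rule mod_mod_cancel[OF pos(4)[folded dvd_eq_mod_eq_0]])

text \<open>A ring vertex and its two neighbours carry all three residues, also across the seam,
  because 3 divides \<open>len\<close>.\<close>

lemma ring_push:
  assumes "w < len" "f < 3"
  obtains w' where "w' < len" "near (Ring w) (Ring w')" "w' mod 3 = f"
proof -
  have "w mod 3 = 0 \<or> w mod 3 = 1 \<or> w mod 3 = 2" by linarith
  moreover have "f = 0 \<or> f = 1 \<or> f = 2" using assms(2) by linarith
  ultimately have "w mod 3 = f \<or> Suc w mod 3 = f \<or> Suc (Suc w) mod 3 = f"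
    by (elim disjE) (simp_all add: mod_Suc)
  then consider "w mod 3 = f" | "Suc w mod 3 = f" | "Suc (Suc w) mod 3 = f" by blast
  then show thesis
  proof cases
    case 1
    then show thesis using that[of w] assms by simp
  next
    case 2
    then show thesis using that[of "Suc w mod len"] mod3_Suc pos(3) by simp
  next
    case 3
    show thesis
    proof (cases w)
      case 0
      have "len - 1 = 3 * M + 2" by (simp add: len_def)
      then have "(len - 1) mod 3 = f"
        using 3 0 by (simp only: mod_mult_self4 mod_mult_self1 mod_mult_self2) simp
      moreover have "Suc (len - 1) mod len = 0" using pos(3) by simp
      ultimately show thesis using that[of "len - 1"] 0 pos(3) by simp
    next
      case (Suc v)
      have "Suc (Suc (Suc v)) = v + 3" by simp
      then have "v mod 3 = f" using 3 Suc by (simp only: mod_add_self2)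
      moreover have "Suc v mod len = w" using Suc assms(1) by simp
      ultimately show thesis using that[of v] Suc assms(1) by simp
    qed
  qed
qed


text \<open>On the ring: if a track is deserted, the robber jumps to its haven; if all are held but
  an alarm or the vault is open, he goes there; otherwise the turn was lawful, he follows the phase
  along the ring, and unless the last three vertices are involved the reading is controlled by
  \<open>Suc c\<close>.\<close>

lemma good_step:
  assumes j: "j \<le> k" and g: "good j P r c" and turn: "cop_turn G j P P'"
    and c: "int c + 1 < span k"
  shows "\<not> caught j P' r \<and> (\<exists>r'. legal_move G r r' \<and> good j P' r' (Suc c))"
proof -
  obtain s x y where r: "r = Rob s x y" and ok: "vert_ok (Rob s x y)" and safe: "safe j P r"
    and ring: "\<And>w. s = Ring w \<Longrightarrow> \<exists>A F. config j P A F \<and> F 0 = w mod 3 \<and> A (k - 1) \<noteq> top \<and>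
       (A (k - 1) = 0 \<or> len - 3 \<le> w \<or>
         (\<exists>v\<le>len - 4. v \<le> Suc w \<and> w \<le> Suc v \<and> lawful A v \<and> pot A v k \<le> int c))"
    using g unfolding good_def by blast
  have P': "\<forall>i<j. vert_ok (P' i)" using turn by (auto simp: cop_turn_def legal_G)
  have free: "\<forall>i<j. P' i \<noteq> Rob s x y"
    using turn safe r unfolding safe_def cop_turn_def by metis
  have "\<exists>r'. legal_move G r r' \<and> good j P' r' (Suc c)"
  proof (cases "\<exists>w. s = Ring w")
    case False
    then show ?thesis using good_start[OF j P' ok _ free] r by blast
  next
    case True
    then obtain w where s: "s = Ring w" by blast
    then have w: "w < len" using ok by simp
    obtain A F where cA: "config j P A F" and F0: "F 0 = w mod 3" and Atop: "A (k - 1) \<noteq> top"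
      and alt: "A (k - 1) = 0 \<or> len - 3 \<le> w \<or>
         (\<exists>v\<le>len - 4. v \<le> Suc w \<and> w \<le> Suc v \<and> lawful A v \<and> pot A v k \<le> int c)"
      using ring[OF s] by blast
    have from_track: "\<exists>t<k. P i = Cop t (A t) (F t) \<and> (P' i = P i \<or> adj (P i) (P' i))" if "i < j" for i
      using config_Cop[OF cA that] turn that by (auto simp: cop_turn_def legal_G)
    show ?thesis
    proof (rule config_cases[OF j P'])
      fix t assume t: "t < k" "\<forall>i<j. \<forall>a f. P' i \<noteq> Cop t a f"
      \<comment> \<open>A cop on a twin point has just come from a track vertex guarding the
        robber's residue. There is none: the phase of track \<open>0\<close> is
        \<open>w mod 3\<close>, and the last cop was not at \<open>top\<close>.\<close>
      have "\<forall>i<j. \<forall>s'. P' i = Rob s' x y \<longrightarrow> cls s' \<noteq> cls s"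
      proof (intro allI impI notI)
        fix i s' assume i: "i < j" and Pi: "P' i = Rob s' x y" "cls s' = cls s"
        obtain t where "t < k" "guards t (A t) (F t) s'"
          using from_track[OF i] Pi by auto
        then show False using Pi(2) s F0 Atop by (cases s') (auto split: if_splits)
      qed
      from escape_to_haven[OF j P' ok t this] show ?thesis
        using goodI_haven r by (metis legal_G site.distinct(1))
    next
      fix A' F' assume c': "config j P' A' F'" and le': "\<forall>t<k. A' t \<le> top" "\<forall>t<k. F' t < 3"
      have close: "A t \<le> Suc (A' t) \<and> A' t \<le> Suc (A t)" if t: "t < k" for t
      proof -
        obtain i where i: "i < j" "P' i = Cop t (A' t) (F' t)" using config_obtain[OF c' t] by blast
        then show ?thesis using from_track[OF i(1)] by auto
      qed
      have le: "A t \<le> top" if t: "t < k" for t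
      proof -
        obtain i where i: "i < j" "P i = Cop t (A t) (F t)" using config_obtain[OF cA t] by blast
        then have "vert_ok (P i)" using turn by (auto simp: cop_turn_def legal_G)
        then show ?thesis using i by simp
      qed
      have to_haven: ?thesis
        if s': "site_ok s'" "near s s'" "\<And>w. s' \<noteq> Ring w"
          and open': "\<And>t. t < k \<Longrightarrow> \<not> guards t (A' t) (F' t) s'" for s'
      proof -
        obtain y' where y': "vert_ok (Rob s' 0 y')" "legal_move G (Rob s x y) (Rob s' 0 y')"
          using rob_neighbour[OF ok s'(1,2), of 0] pos by auto
        moreover have "safe j P' (Rob s' 0 y')" by (rule safe_config[OF c' open'])
        ultimately show ?thesis using goodI_haven s' r by blast
      qed
      consider t b where "t < k" "gate b (A' t)"
          "if t = 0 then w \<noteq> ring_corner b else A' (t - 1) \<noteq> corner b"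
        | "len - 3 \<le> w" "A' (k - 1) \<noteq> 0"
        | "lawful A' w" "len - 3 \<le> w \<longrightarrow> A' (k - 1) = 0"
        unfolding lawful_def consistent_def by (metis (full_types))
      then show ?thesis
      proof cases
        case 1
        show ?thesis
        proof (rule to_haven)
          show "near s (Alarm t b)" using 1(3) s by auto
          fix u assume "u < k"
          show "\<not> guards u (A' u) (F' u) (Alarm t b)"
            using 1 by (cases "u = t") (auto split: if_splits)
        qed (use 1 in auto)
      next
        case 2
        show ?thesis by (rule to_haven[of Vault]) (use 2 s in auto)
      next
        case 3
        obtain w' where w': "w' < len" "near (Ring w) (Ring w')" "w' mod 3 = F' 0"
          using ring_push[OF w, of "F' 0"] le' k by auto
        \<comment> \<open>The current vertex \<open>w\<close> becomes the next witness
          \<open>v\<close>. If the last cop was at \<open>0\<close>, she is now at most at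
          \<open>1\<close> and the reading is \<open>0\<close>; otherwise it has grown by at most
          one.\<close>
        have bound: "pot A' w k \<le> int (Suc c)" if "w \<le> len - 4"
        proof -
          have range: "pot A' w t \<le> span t" if "t \<le> k" for t
            using pot_range[of w t A'] le' that \<open>w \<le> len - 4\<close> by simp
          have Suck: "k = Suc (k - 1)" using k by simp
          have "\<not> len - 3 \<le> w" using \<open>w \<le> len - 4\<close> pos(3) by simp
          then have "A (k - 1) = 0 \<or>
              (\<exists>v\<le>len - 4. v \<le> Suc w \<and> w \<le> Suc v \<and> lawful A v \<and> pot A v k \<le> int c)"
            using alt by (simp only: simp_thms)
          then show ?thesis
          proof (elim disjE exE conjE)
            assume "A (k - 1) = 0"
            then have "A' (k - 1) \<le> 1" using close[of "k - 1"] k by simp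
            then have "pot A' w (Suc (k - 1)) = 0"
              unfolding pot.simps using range[of "k - 1"] span_nonneg by (intro level_start) simp_all
            then show ?thesis using Suck by simp
          next
            fix v assume v: "v \<le> len - 4" "v \<le> Suc w" "w \<le> Suc v" "lawful A v" "pot A v k \<le> int c"
            have "\<bar>pot A v k - pot A' w k\<bar> \<le> 1"
              by (rule pot_lipschitz[OF v(4) 3(1) v(1) \<open>w \<le> len - 4\<close> v(2,3)])
                (use le le' close in simp_all)
            then show ?thesis using v(5) by simp
          qed
        qed
        \<comment> \<open>At \<open>top\<close> the reading would be all of \<open>span k\<close>,
          more than the rounds played so far allow.\<close>
        have top': "A' (k - 1) \<noteq> top"
        proof
          assume top: "A' (k - 1) = top"
          then have "\<not> len - 3 \<le> w" using 3 by (auto simp: top_def)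
          then have "pot A' w k \<le> int (Suc c)" using bound by simp
          moreover have "pot A' w (Suc (k - 1)) = span (Suc (k - 1))"
            using top level_end[OF span_nonneg, of "k - 1" M] by (simp add: top_def)
          ultimately show False using c k by simp
        qed
        have "near s (Ring w')" using w' s by simp
        then obtain y' where y': "vert_ok (Rob (Ring w') 0 y')" "legal_move G (Rob s x y) (Rob (Ring w') 0 y')"
          using rob_neighbour[OF ok, of "Ring w'" 0] pos w' by auto
        have "safe j P' (Rob (Ring w') 0 y')"
        proof (rule safe_config[OF c'])
          show "\<not> guards t (A' t) (F' t) (Ring w')" for t
            using w'(3) top' by (cases "t = 0") auto
        qed
        moreover have "A' (k - 1) = 0 \<or> len - 3 \<le> w' \<or>
            (\<exists>v\<le>len - 4. v \<le> Suc w' \<and> w' \<le> Suc v \<and> lawful A' v \<and> pot A' v k \<le> int (Suc c))"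
        proof (cases "len - 3 \<le> w \<or> len - 3 \<le> w'")
          case True
          then show ?thesis using 3 by blast
        next
          case False
          then have lw: "w \<le> len - 4" "w' \<le> len - 4" by auto
          moreover have "w \<le> Suc w'" "w' \<le> Suc w" using w'(2) lw pos(3) by auto
          ultimately show ?thesis using 3 bound by blast
        qed
        ultimately have "good j P' (Rob (Ring w') 0 y') (Suc c)"
          by (intro goodI_ring[OF y'(1) _ c' w'(3)[symmetric] top'])
        then show ?thesis using y'(2) r by blast
      qed
    qed
  qed
  moreover have "\<not> caught j P' r" using free r by (auto simp: caught_def)
  ultimately show ?thesis by blast
qed


section \<open>Survival against \<open>k\<close> cops and against fewer\<close>

lemma good_not_caught: "good j P r c \<Longrightarrow> \<forall>i<j. vert_ok (P i) \<Longrightarrow> \<not> caught j P r"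
  by (auto simp: good_def safe_def caught_def legal_G)

lemma good_survives:
  assumes "j \<le> k" "good j P r c" "\<forall>i<j. vert_ok (P i)" "int (c + n) < span k"
  shows "\<not> win_in G j n P r"
  using assms(2-)
proof (induction n arbitrary: P r c)
  case 0
  then show ?case using good_not_caught by simp
next
  case (Suc n)
  have "\<not> win_in G j n P r" using Suc.IH[OF Suc.prems(1,2)] Suc.prems(3) by simp
  moreover have "\<not> caught j P' r \<and> (\<exists>r'. legal_move G r r' \<and> \<not> win_in G j n P' r')"
    if turn: "cop_turn G j P P'" for P'
  proof -
    have "\<forall>i<j. vert_ok (P' i)" using turn by (auto simp: cop_turn_def legal_G)
    then show ?thesis
      using good_step[OF assms(1) Suc.prems(1) turn] Suc.IH[of P' _ "Suc c"] Suc.prems(3)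
      by fastforce
  qed
  ultimately show ?case by auto
qed

text \<open>Fewer than \<open>k\<close> cops always leave a track deserted, so the robber moves from
  haven to haven and no potential limits him.\<close>

lemma few_cops_survive:
  assumes j: "j < k"
  shows "\<lbrakk>\<forall>i<j. vert_ok (P i); vert_ok (Rob s x y); \<And>w. s \<noteq> Ring w; safe j P (Rob s x y)\<rbrakk>
    \<Longrightarrow> \<not> win_in G j n P (Rob s x y)"
proof (induction n arbitrary: P s x y)
  case 0
  then show ?case by (auto simp: caught_def safe_def legal_G)
next
  case (Suc n)
  have "\<not> caught j P' (Rob s x y) \<and> (\<exists>r'. legal_move G (Rob s x y) r' \<and> \<not> win_in G j n P' r')"
    if turn: "cop_turn G j P P'" for P'
  proof -
    have P': "\<forall>i<j. vert_ok (P' i)" using turn by (auto simp: cop_turn_def legal_G)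
    have free: "\<forall>i<j. P' i \<noteq> Rob s x y"
      using turn Suc.prems(4) unfolding safe_def cop_turn_def by metis
    obtain r' where r': "legal_move G (Rob s x y) r'" "good j P' r' 0" "\<forall>w x y. r' \<noteq> Rob (Ring w) x y"
      using good_start[OF less_imp_le[OF j] P' Suc.prems(2,3) free] j by blast
    then obtain s' x' y' where "r' = Rob s' x' y'" "vert_ok (Rob s' x' y')" "safe j P' (Rob s' x' y')"
      "\<And>w. s' \<noteq> Ring w"
      unfolding good_def by blast
    then show ?thesis using Suc.IH[OF P'] r'(1) free by (auto simp: caught_def)
  qed
  then show ?case using Suc by auto
qed

text \<open>Some point of a haven is unoccupied, since \<open>d\<close> exceeds \<open>k\<close>.
  The robber imagines standing there and starts at the vertex of his reply.\<close>

lemma robber_start: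
  assumes j: "j \<le> k" and P: "\<forall>i<j. vert_ok (P i)"
  shows "\<exists>r. good j P r 0 \<and> (j < k \<longrightarrow> (\<forall>w x y. r \<noteq> Rob (Ring w) x y))"
proof -
  let ?S = "(\<lambda>x. Rob (Haven 0) x 0) ` {..<d}"
  have "card ?S = d" by (subst card_image) (auto intro: inj_onI)
  moreover have "card (P ` {..<j}) \<le> j" using card_image_le[of "{..<j}" P] by simp
  ultimately have "card (P ` {..<j}) < card ?S" using j by (simp add: d_def)
  then have "\<not> ?S \<subseteq> P ` {..<j}" by (meson card_mono finite_imageI finite_lessThan leD)
  then obtain x where x: "x < d" "Rob (Haven 0) x 0 \<notin> P ` {..<j}" by auto
  then have "\<forall>i<j. P i \<noteq> Rob (Haven 0) x 0" by (metis imageI lessThan_iff)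
  moreover have "vert_ok (Rob (Haven 0) x 0)" using x k pos by simp
  ultimately show ?thesis using good_start[OF j P, of "Haven 0" x 0 0] by blast
qed

lemma good_vert_ok: "good j P r c \<Longrightarrow> vert_ok r"
  by (auto simp: good_def)

theorem slow: "cops_win_within G k n \<Longrightarrow> span k \<le> int n"
proof (rule ccontr)
  assume "cops_win_within G k n" and n: "\<not> span k \<le> int n"
  then obtain P where P: "\<forall>i<k. vert_ok (P i)" "\<forall>r\<in>pverts G. win_in G k n P r"
    unfolding cops_win_within_iff by auto
  obtain r where r: "good k P r 0" using robber_start[OF order_refl P(1)] by blast
  then have "\<not> win_in G k n P r" using good_survives[OF order_refl r P(1), of n] n by simp
  then show False using P(2) good_vert_ok[OF r] by simp
qed

theorem few_cops_lose: "j < k \<Longrightarrow> \<not> cops_win_within G j n"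
proof
  assume j: "j < k" and "cops_win_within G j n"
  then obtain P where P: "\<forall>i<j. vert_ok (P i)" "\<forall>r\<in>pverts G. win_in G j n P r"
    unfolding cops_win_within_iff by auto
  obtain r where r: "good j P r 0" "j < k \<longrightarrow> (\<forall>w x y. r \<noteq> Rob (Ring w) x y)"
    using robber_start[OF less_imp_le[OF j] P(1)] by blast
  then obtain s x y where s: "r = Rob s x y" "vert_ok (Rob s x y)" "safe j P (Rob s x y)" "\<And>w. s \<noteq> Ring w"
    using j unfolding good_def by blast
  then have "\<not> win_in G j n P r" using few_cops_survive[OF j P(1) s(2,4,3)] by simp
  then show False using P(2) s by simp
qed


section \<open>The strategy of the cops\<close>

definition wins :: "(nat \<Rightarrow> vert) \<Rightarrow> vert \<Rightarrow> bool" where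
  "wins P r \<longleftrightarrow> (\<exists>n. win_in G k n P r)"

text \<open>The replies are finitely many, so the largest of their round counts serves for
  all.\<close>

lemma wins_step:
  assumes turn: "cop_turn G k P P'" and all: "\<And>r'. legal_move G r r' \<Longrightarrow> wins P' r'"
  shows "wins P r"
proof -
  obtain N where N: "\<And>r'. legal_move G r r' \<Longrightarrow> win_in G k (N r') P' r'"
    using all unfolding wins_def by metis
  define m where "m = Max (N ` pverts G)"
  have "win_in G k m P' r'" if "legal_move G r r'" for r'
  proof (rule win_in_mono[OF N[OF that]])
    show "N r' \<le> m"
      unfolding m_def using finite_pverts_G legal_moveD(2)[OF that] by (intro Max_ge) simp_all
  qed
  then have "win_in G k (Suc m) P r" using turn by (simp only: win_in.simps) blast
  then show ?thesis unfolding wins_def by blast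
qed

lemma wins_hit:
  assumes P: "\<And>j. j < k \<Longrightarrow> vert_ok (P j)" and i: "i < k" "legal_move G (P i) r"
  shows "wins P r"
proof -
  have "cop_turn G k P (P(i := r))" using P i by (auto simp: cop_turn_def legal_G)
  moreover have "caught k (P(i := r)) r" using i(1) unfolding caught_def by (intro exI[of _ i]) simp
  ultimately have "win_in G k (Suc 0) P r" by (simp only: win_in.simps) blast
  then show ?thesis unfolding wins_def by blast
qed

definition team :: "(nat \<Rightarrow> nat) \<Rightarrow> nat \<Rightarrow> nat \<Rightarrow> vert" where
  "team A f t = Cop t (A t) f"

definition tracks_ok :: "(nat \<Rightarrow> nat) \<Rightarrow> bool" where
  "tracks_ok A \<longleftrightarrow> (\<forall>t<k. A t \<le> top)"

lemma team_ok: "tracks_ok A \<Longrightarrow> f < 3 \<Longrightarrow> t < k \<Longrightarrow> vert_ok (team A f t)"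
  by (simp add: team_def tracks_ok_def)

lemma team_hub_turn:
  assumes "tracks_ok A" "f < 3"
  shows "cop_turn G k (team A f) ((team A f)(i := Hub))"
    and "j < k \<Longrightarrow> vert_ok (((team A f)(i := Hub)) j)"
proof -
  show "cop_turn G k (team A f) ((team A f)(i := Hub))"
    using team_ok[OF assms] by (auto simp: cop_turn_def legal_G) (simp add: team_def)
  show "vert_ok (((team A f)(i := Hub)) j)" if "j < k"
    using team_ok[OF assms that] by simp
qed

lemma wins_guarded:
  assumes "tracks_ok A" "f < 3" "t < k" "guards t (A t) f s" "vert_ok (Rob s x y)"
  shows "wins (team A f) (Rob s x y)"
proof (rule wins_hit[OF team_ok[OF assms(1,2)] assms(3)])
  show "legal_move G (team A f t) (Rob s x y)"
    using team_ok[OF assms(1-3)] assms(4,5) by (simp add: legal_G team_def)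
qed

lemma wins_Hub:
  assumes "tracks_ok A" "f < 3"
  shows "wins (team A f) Hub"
proof (rule wins_hit[OF team_ok[OF assms]])
  show "0 < k" using k by simp
  then show "legal_move G (team A f 0) Hub"
    using team_ok[OF assms, of 0] by (simp add: legal_G team_def)
qed

lemma wins_Leaf:
  assumes "tracks_ok A" "f < 3" "i < e"
  shows "wins (team A f) (Leaf i)"
proof (rule wins_step[OF team_hub_turn(1)[OF assms(1,2), of 0]])
  fix r' assume r': "legal_move G (Leaf i) r'"
  have "0 < k" using k by simp
  show "wins ((team A f)(0 := Hub)) r'"
  proof (rule wins_hit[OF team_hub_turn(2)[OF assms(1,2)] \<open>0 < k\<close>])
    show "legal_move G (((team A f)(0 := Hub)) 0) r'"
      using r' by (cases r') (auto simp: legal_G)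
  qed
qed

text \<open>A robber who enters the track of cop \<open>t\<close> is trapped: another cop steps onto the hub, which
  controls everything except the havens, while the only haven adjacent to that track is controlled
  by cop \<open>t\<close> herself.  This is where a second cop is indispensable.\<close>

lemma wins_Cop:
  assumes A: "tracks_ok A" "f < 3" and c: "vert_ok (Cop t a g)"
  shows "wins (team A f) (Cop t a g)"
proof -
  define i where "i = (if t = 0 then 1 else 0 :: nat)"
  have i: "i < k" "i \<noteq> t" and t: "t < k" using k c by (auto simp: i_def)
  let ?P = "(team A f)(i := Hub)"
  show ?thesis
  proof (rule wins_step[OF team_hub_turn(1)[OF A, of i]])
    fix r' assume r': "legal_move G (Cop t a g) r'"
    then have ok: "vert_ok r'" by (simp add: legal_G)
    have "legal_move G (?P i) r' \<or> legal_move G (?P t) r'"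
    proof (cases r')
      case (Rob s x y)
      show ?thesis
      proof (cases "\<exists>j. s = Haven j")
        case True
        then have "s = Haven t" using r' Rob by (auto simp: legal_G)
        then show ?thesis using Rob ok i(2) team_ok[OF A t] by (simp add: legal_G team_def)
      next
        case False
        then show ?thesis using Rob ok by (simp add: legal_G)
      qed
    next
      case (Leaf j)
      then show ?thesis using r' by (simp add: legal_G)
    qed (use ok in \<open>simp_all add: legal_G\<close>)
    moreover have "\<And>j. j < k \<Longrightarrow> vert_ok (?P j)"
      by (rule team_hub_turn(2)[OF A])
    ultimately show "wins ?P r'"
      using wins_hit[of ?P] i(1) t by blast
  qed
qed

section \<open>Driving the robber around the ring\<close>

definition ring_won :: "(nat \<Rightarrow> nat) \<Rightarrow> nat \<Rightarrow> nat \<Rightarrow> bool" where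
  "ring_won A f w \<longleftrightarrow> (\<forall>x<d. \<forall>y<q. wins (team A f) (Rob (Ring w) x y))"

lemma Suc_mod3:
  "Suc m mod 3 \<noteq> m mod 3"
  "Suc m mod 3 = n mod 3 \<Longrightarrow> Suc n mod 3 \<noteq> m mod 3"
  by (auto simp: mod_Suc split: if_splits)

text \<open>Counterpart of \<open>ring_push\<close>: the three residues occur once each, so the
  phase leaves the robber a single place on the ring.\<close>

lemma ring_neighbour_unique:
  assumes "u < len" "u' < len" "near (Ring w) (Ring u)" "near (Ring w) (Ring u')" "u mod 3 = u' mod 3"
  shows "u = u'"
proof -
  have cyc: "Suc v mod 3 = w mod 3" if "w = Suc v mod len" for v
    using mod3_Suc[of v] that by simp
  have fwd: "Suc w mod 3 = v mod 3" if "v = Suc w mod len" for v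
    using mod3_Suc[of w] that by simp
  have inj: "u = u'" if "Suc u mod len = Suc u' mod len"
  proof -
    have "Suc v mod len = (if Suc v = len then 0 else Suc v)" if "v < len" for v
      using that by simp
    then show ?thesis using that assms(1,2) by (auto split: if_splits)
  qed
  consider "u = w" "u' = w" | "u = w" "u' = Suc w mod len" | "u = w" "w = Suc u' mod len"
    | "u = Suc w mod len" "u' = w" | "u = Suc w mod len" "u' = Suc w mod len"
    | "u = Suc w mod len" "w = Suc u' mod len"
    | "w = Suc u mod len" "u' = w" | "w = Suc u mod len" "u' = Suc w mod len"
    | "w = Suc u mod len" "w = Suc u' mod len"
    using assms(3,4) unfolding near.simps by blast
  then show ?thesis
  proof cases
    case 2
    then show ?thesis using fwd[OF 2(2)] assms(5) Suc_mod3(1)[of w] by metis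
  next
    case 3
    then show ?thesis using cyc[OF 3(2)] assms(5) Suc_mod3(1)[of u'] by metis
  next
    case 4
    then show ?thesis using fwd[OF 4(1)] assms(5) Suc_mod3(1)[of w] by metis
  next
    case 6
    then show ?thesis using fwd[OF 6(1)] cyc[OF 6(2)] assms(5) Suc_mod3(2)[of w u'] by metis
  next
    case 7
    then show ?thesis using cyc[OF 7(1)] assms(5) Suc_mod3(1)[of u] by metis
  next
    case 8
    then show ?thesis using fwd[OF 8(2)] cyc[OF 8(1)] assms(5) Suc_mod3(2)[of w u] by metis
  next
    case 9
    then show ?thesis using inj by metis
  qed (simp_all only:)
qed

text \<open>Every reply except \<open>Ring w'\<close> loses at once or is trapped: cop
  \<open>0\<close> guards the other residues, each haven has its cop, lawfulness closes the alarms,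
  \<open>entry\<close> closes the vault, and tracks and hub are losing anyway.\<close>

lemma push:
  assumes A: "tracks_ok A" "f < 3" and A': "tracks_ok A'" "f' < 3"
    and close: "\<And>t. A t \<le> Suc (A' t)" "\<And>t. A' t \<le> Suc (A t)"
    and w': "w' < len" "near (Ring w) (Ring w')" "w' mod 3 = f'"
    and lawful: "lawful A' w" and entry: "len - 3 \<le> w \<Longrightarrow> A' (k - 1) = 0"
    and won: "ring_won A' f' w'"
  shows "ring_won A f w"
  unfolding ring_won_def
proof (intro allI impI)
  fix x y assume "x < d" "y < q"
  have k1: "k - 1 < k" "0 < k" using k by simp_all
  have turn: "cop_turn G k (team A f) (team A' f')"
    using team_ok[OF A] team_ok[OF A'] close by (simp add: cop_turn_def legal_G) (simp add: team_def)
  show "wins (team A f) (Rob (Ring w) x y)"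
  proof (rule wins_step[OF turn])
    fix r' assume r': "legal_move G (Rob (Ring w) x y) r'"
    then have ok: "vert_ok r'" by (simp add: legal_G)
    show "wins (team A' f') r'"
    proof (cases r')
      case (Cop t a g)
      then show ?thesis using wins_Cop[OF A'] ok by simp
    next
      case Hub
      then show ?thesis using wins_Hub[OF A'] by simp
    next
      case (Leaf i)
      then show ?thesis using r' by (simp add: legal_G)
    next
      case (Rob s x' y')
      have near: "near (Ring w) s" using r' Rob by (auto simp: legal_G)
      have guarded: ?thesis if "t < k" "guards t (A' t) f' s" for t
        using wins_guarded[OF A' that] ok Rob by simp
      show ?thesis
      proof (cases s)
        case (Ring u)
        show ?thesis
        proof (cases "u mod 3 = f'")
          case True
          then have "u = w'" using ring_neighbour_unique[of u w' w] near Ring ok Rob w' by simp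
          then show ?thesis using won ok Rob Ring by (simp add: ring_won_def)
        next
          case False
          then show ?thesis using guarded[of 0] Ring k1 by simp
        qed
      next
        case (Haven i)
        then show ?thesis using guarded[of i] ok Rob by simp
      next
        case Vault
        then show ?thesis using guarded[of "k - 1"] near entry k1 by simp
      next
        case (Alarm i b)
        then have i: "i < k" using ok Rob by simp
        show ?thesis
        proof (cases "gate b (A' i)")
          case False
          then show ?thesis using guarded[of i] i Alarm by simp
        next
          case True
          have con: "if i = 0 then w = ring_corner b else A' (i - 1) = corner b"
            using lawful i True unfolding lawful_def consistent_def by blast
          then have "i \<noteq> 0" using near Alarm by auto
          then show ?thesis using guarded[of "i - 1"] con i Alarm by simp
        qed
      qed
    qed
  qed
qed

section \<open>Odometer states and their traversal\<close>

definition state_ok :: "(nat \<Rightarrow> nat) \<times> nat \<Rightarrow> bool" where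
  "state_ok S \<longleftrightarrow> tracks_ok (fst S) \<and> snd S \<le> len - 4 \<and> lawful (fst S) (snd S)"

text \<open>Tracks and ring move separately, so the new tracks are lawful for the old robber vertex,
  as \<open>push\<close> demands. The relation is symmetric, which allows sweeps to be
  reversed.\<close>

definition step :: "(nat \<Rightarrow> nat) \<times> nat \<Rightarrow> (nat \<Rightarrow> nat) \<times> nat \<Rightarrow> bool" where
  "step S S' \<longleftrightarrow> state_ok S \<and> state_ok S' \<and>
     (snd S = snd S' \<and> (\<forall>t. fst S t \<le> Suc (fst S' t) \<and> fst S' t \<le> Suc (fst S t)) \<or>
      fst S = fst S' \<and> (snd S' = Suc (snd S) \<or> snd S = Suc (snd S')))"

lemma step_sym: "step S S' \<Longrightarrow> step S' S"
  unfolding step_def by auto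

lemma reach_sym: "step\<^sup>*\<^sup>* S S' \<Longrightarrow> step\<^sup>*\<^sup>* S' S"
  by (induction rule: rtranclp_induct) (auto intro: converse_rtranclp_into_rtranclp step_sym)

definition state_won :: "(nat \<Rightarrow> nat) \<times> nat \<Rightarrow> bool" where
  "state_won S \<longleftrightarrow> ring_won (fst S) (snd S mod 3) (snd S)"

lemma step_won:
  assumes step: "step S S'" and won: "state_won S'"
  shows "state_won S"
proof -
  have S: "tracks_ok (fst S)" "snd S \<le> len - 4" "lawful (fst S) (snd S)"
    and S': "tracks_ok (fst S')" "snd S' \<le> len - 4" "lawful (fst S') (snd S')"
    using step by (auto simp: step_def state_ok_def)
  have cases: "snd S = snd S' \<and> (\<forall>t. fst S t \<le> Suc (fst S' t) \<and> fst S' t \<le> Suc (fst S t)) \<or>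
      fst S = fst S' \<and> (snd S' = Suc (snd S) \<or> snd S = Suc (snd S'))"
    using step by (simp add: step_def)
  have close: "fst S t \<le> Suc (fst S' t)" "fst S' t \<le> Suc (fst S t)" for t
    using cases by auto
  have law: "lawful (fst S') (snd S)" using cases S(3) S'(3) by auto
  have near: "near (Ring (snd S)) (Ring (snd S'))"
    using cases S(2) S'(2) pos(3) by auto
  show ?thesis unfolding state_won_def
  proof (rule push[OF S(1) _ S'(1) _ close _ near refl law])
    show "ring_won (fst S') (snd S' mod 3) (snd S')" using won by (simp add: state_won_def)
  qed (use S(2) S'(2) pos(3) in auto)
qed

lemma reach_won: "step\<^sup>*\<^sup>* S S' \<Longrightarrow> state_won S' \<Longrightarrow> state_won S"
  by (induction rule: converse_rtranclp_induct) (auto intro: step_won)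

definition fill :: "nat \<Rightarrow> nat \<Rightarrow> (nat \<Rightarrow> nat) \<Rightarrow> nat \<Rightarrow> nat" where
  "fill n z A t = (if t < n then z else A t)"

lemma gate_top: "gate b top \<longleftrightarrow> b"
  using gate_simps(2)[of M] gate_simps(5)[of M] by (cases b) (simp_all add: top_def)

lemma gate_Suc:
  "gate b (Suc (4 * c)) \<longleftrightarrow> False"
  "gate b (Suc (Suc (4 * c))) \<longleftrightarrow> b"
  "gate b (Suc (Suc (Suc (4 * c)))) \<longleftrightarrow> False"
  "gate b (Suc (Suc (Suc (Suc (4 * c))))) \<longleftrightarrow> \<not> b"
proof -
  have "gate b (4 * c + 1) \<longleftrightarrow> False" "gate b (4 * c + 2) \<longleftrightarrow> b"
    "gate b (4 * c + 3) \<longleftrightarrow> False" "gate b (4 * Suc c) \<longleftrightarrow> \<not> b"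
    using gate_simps(4)[of b c] gate_simps(2,5)[of c] gate_simps(6)[of b c] gate_simps(1,3)[of "Suc c"]
    by (cases b; simp only: zero_less_Suc simp_thms)+
  moreover have "4 * c + 1 = Suc (4 * c)" "4 * c + 2 = Suc (Suc (4 * c))"
    "4 * c + 3 = Suc (Suc (Suc (4 * c)))" "4 * Suc c = Suc (Suc (Suc (Suc (4 * c))))"
    by simp_all
  ultimately show "gate b (Suc (4 * c)) \<longleftrightarrow> False" "gate b (Suc (Suc (4 * c))) \<longleftrightarrow> b"
    "gate b (Suc (Suc (Suc (4 * c)))) \<longleftrightarrow> False" "gate b (Suc (Suc (Suc (Suc (4 * c))))) \<longleftrightarrow> \<not> b"
    by (simp_all only:)
qed

lemma consistentI:
  assumes "\<And>b. gate b (A t) \<Longrightarrow> b = c" "t = 0 \<Longrightarrow> w = ring_corner c" "t \<noteq> 0 \<Longrightarrow> A (t - 1) = corner c"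
  shows "consistent t A w"
  unfolding consistent_def
proof (intro allI impI)
  fix b assume "gate b (A t)"
  then have "b = c" by (rule assms(1))
  then show "if t = 0 then w = ring_corner b else A (t - 1) = corner b"
    using assms(2,3) by (cases "t = 0") (simp_all only: if_True if_False simp_thms)
qed

text \<open>Digits standing at the same corner \<open>c\<close> satisfy each other's gates; digit
  \<open>n\<close> meets only gates of kind \<open>c\<close>, and the digit above it is off its
  gates.\<close>

lemma corner_state_ok:
  assumes A: "tracks_ok A" and n: "n < k" and a: "a \<le> top" "\<And>b. gate b a \<Longrightarrow> b = c"
    and above: "Suc n < k \<Longrightarrow> \<forall>b. \<not> gate b (A (Suc n))" "\<And>t. Suc n < t \<Longrightarrow> t < k \<Longrightarrow> consistent t A 0"
  shows "state_ok (fill n (corner c) (A(n := a)), ring_corner c)"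
proof -
  let ?B = "fill n (corner c) (A(n := a))"
  have "consistent t ?B (ring_corner c)" if t: "t < k" for t
  proof -
    consider "t < n" | "t = n" | "t = Suc n" | "Suc n < t" by linarith
    then show ?thesis
    proof cases
      case 1
      show ?thesis
      proof (rule consistentI)
        show "gate b (?B t) \<Longrightarrow> b = c" for b using 1 by (cases c) (simp_all add: fill_def gate_top)
        show "?B (t - 1) = corner c" using 1 by (simp add: fill_def less_imp_diff_less)
      qed simp
    next
      case 2
      show ?thesis
      proof (rule consistentI)
        show "gate b (?B t) \<Longrightarrow> b = c" for b using a(2) 2 by (simp add: fill_def)
        show "t \<noteq> 0 \<Longrightarrow> ?B (t - 1) = corner c" using 2 by (simp add: fill_def)
      qed simp
    next
      case 3
      then have "\<not> gate b (?B t)" for b using above(1) t by (simp add: fill_def)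
      then show ?thesis unfolding consistent_def by blast
    next
      case 4
      then have "?B t = A t" "?B (t - 1) = A (t - 1)" "t \<noteq> 0" by (auto simp: fill_def)
      then show ?thesis using above(2)[OF 4 t] unfolding consistent_def by simp
    qed
  qed
  moreover have "tracks_ok ?B" using A a(1) unfolding tracks_ok_def fill_def by auto
  ultimately show ?thesis by (simp add: state_ok_def lawful_def)
qed

text \<open>The highest moving digit climbs its track once while those below sweep up at
  \<open>4 * c + 1\<close> and down at \<open>4 * c + 3\<close>. Digit \<open>n\<close> must be off
  its gates, or it would fix the end at which the moving digits stand.\<close>

lemma traverse:
  assumes "n \<le> k" "tracks_ok A" "n < k \<Longrightarrow> \<forall>b. \<not> gate b (A n)"
    and "\<And>t. n < t \<Longrightarrow> t < k \<Longrightarrow> consistent t A 0"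
  shows "step\<^sup>*\<^sup>* (fill n 0 A, 0) (fill n top A, len - 4)"
  using assms
proof (induction n arbitrary: A)
  case 0
  have fill0: "fill 0 z A = A" for z by (auto simp: fill_def)
  have law: "lawful A w" for w unfolding lawful_def
  proof (intro allI impI)
    fix t assume t: "t < k"
    show "consistent t A w"
    proof (cases "t = 0")
      case True
      then show ?thesis using 0(3) t unfolding consistent_def by auto
    next
      case False
      then show ?thesis using 0(4)[of t] t unfolding consistent_def by simp
    qed
  qed
  have "step\<^sup>*\<^sup>* (A, 0) (A, w)" if "w \<le> len - 4" for w
    using that
  proof (induction w)
    case (Suc w)
    moreover have "step (A, w) (A, Suc w)"
      using 0(2) law Suc.prems by (simp add: step_def state_ok_def)
    ultimately show ?case by (simp add: rtranclp.rtrancl_into_rtrancl)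
  qed simp
  then show ?case by (simp add: fill0)
next
  case (Suc n)
  have n: "n < k" using Suc.prems(1) by simp
  \<comment> \<open>Digit \<open>n\<close> is at \<open>a\<close>, and everything below it at the
    end \<open>c\<close>.\<close>
  define St where "St c a = (fill n (corner c) (A(n := a)), ring_corner c)" for c a
  have ok: "state_ok (St c a)" if "a \<le> top" "\<And>b. gate b a \<Longrightarrow> b = c" for c a
    unfolding St_def using Suc.prems that n by (intro corner_state_ok) auto
  have move: "step\<^sup>*\<^sup>* (St c a) (St c (Suc a))"
    if "Suc a \<le> top" "\<And>b. gate b a \<Longrightarrow> b = c" "\<And>b. gate b (Suc a) \<Longrightarrow> b = c" for c a
  proof (rule r_into_rtranclp)
    have "fst (St c a) t \<le> Suc (fst (St c (Suc a)) t) \<and> fst (St c (Suc a)) t \<le> Suc (fst (St c a) t)" for t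
      by (simp add: St_def fill_def)
    moreover have "snd (St c a) = snd (St c (Suc a))" by (simp add: St_def)
    ultimately show "step (St c a) (St c (Suc a))"
      using ok[of a c] ok[of "Suc a" c] that unfolding step_def by simp
  qed
  have sweep: "step\<^sup>*\<^sup>* (St False a) (St True a)" if "a \<le> top" "\<And>b. \<not> gate b a" for a
  proof -
    have "step\<^sup>*\<^sup>* (fill n 0 (A(n := a)), 0) (fill n top (A(n := a)), len - 4)"
    proof (rule Suc.IH)
      show "tracks_ok (A(n := a))" using Suc.prems(2) that(1) by (auto simp: tracks_ok_def)
      fix t assume t: "n < t" "t < k"
      show "consistent t (A(n := a)) 0"
      proof (cases "t = Suc n")
        case True
        then show ?thesis using Suc.prems(3) t by (simp add: consistent_def)
      next
        case False
        then have "consistent t A 0" using Suc.prems(4) t by simp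
        then show ?thesis using t False by (auto simp: consistent_def)
      qed
    qed (use n that in auto)
    then show ?thesis by (simp add: St_def)
  qed
  have up: "step\<^sup>*\<^sup>* (St False (Suc (4 * c))) (St True (Suc (Suc (4 * c))))"
    if "Suc (Suc (4 * c)) \<le> top" for c
  proof (rule rtranclp_trans)
    show "step\<^sup>*\<^sup>* (St False (Suc (4 * c))) (St True (Suc (4 * c)))"
      by (rule sweep) (use that gate_Suc in simp_all)
    show "step\<^sup>*\<^sup>* (St True (Suc (4 * c))) (St True (Suc (Suc (4 * c))))"
      by (rule move) (use that gate_Suc in simp_all)
  qed
  have "step\<^sup>*\<^sup>* (St False 0) (St True (Suc (Suc (4 * c))))" if "c \<le> M" for c
    using that
  proof (induction c)
    case 0
    have "step\<^sup>*\<^sup>* (St False 0) (St False (Suc 0))"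
      by (rule move) (use gate_Suc(1)[of _ 0] in \<open>simp_all add: top_def\<close>)
    moreover have "step\<^sup>*\<^sup>* (St False (Suc 0)) (St True (Suc (Suc 0)))"
      using up[of 0] by (simp add: top_def)
    ultimately show ?case by (simp add: rtranclp_trans)
  next
    case (Suc c)
    have le: "Suc (Suc (Suc (Suc (Suc (Suc (4 * c)))))) \<le> top"
      using Suc.prems by (simp add: top_def)
    have eq: "4 * Suc c = Suc (Suc (Suc (Suc (4 * c))))" by simp
    have 1: "step\<^sup>*\<^sup>* (St False 0) (St True (Suc (Suc (4 * c))))"
      using Suc by simp
    have 2: "step\<^sup>*\<^sup>* (St True (Suc (Suc (4 * c)))) (St True (Suc (Suc (Suc (4 * c)))))"
      by (rule move) (use le gate_Suc in simp_all)
    have 3: "step\<^sup>*\<^sup>* (St True (Suc (Suc (Suc (4 * c))))) (St False (Suc (Suc (Suc (4 * c)))))"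
      by (rule reach_sym[OF sweep]) (use le gate_Suc in simp_all)
    have 4: "step\<^sup>*\<^sup>* (St False (Suc (Suc (Suc (4 * c))))) (St False (Suc (Suc (Suc (Suc (4 * c))))))"
      by (rule move) (use le gate_Suc in simp_all)
    have 5: "step\<^sup>*\<^sup>* (St False (Suc (Suc (Suc (Suc (4 * c)))))) (St False (Suc (Suc (Suc (Suc (Suc (4 * c)))))))"
      by (rule move) (use le gate_Suc(4) gate_Suc(1)[of _ "Suc c", unfolded eq] in simp_all)
    have 6: "step\<^sup>*\<^sup>* (St False (Suc (Suc (Suc (Suc (Suc (4 * c))))))) (St True (Suc (Suc (4 * Suc c))))"
      using up[of "Suc c"] le unfolding eq by blast
    show ?case
      by (rule rtranclp_trans[OF 1 rtranclp_trans[OF 2 rtranclp_trans[OF 3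
            rtranclp_trans[OF 4 rtranclp_trans[OF 5 6]]]]])
  qed
  from this[of M] have "step\<^sup>*\<^sup>* (St False 0) (St True top)" by (simp add: top_def)
  moreover have "fill n z (A(n := z)) = fill (Suc n) z A" for z
    by (auto simp: fill_def)
  ultimately show ?case by (simp add: St_def)
qed

text \<open>For \<open>w = 0\<close> a full traversal brings the last cop to \<open>top\<close>,
  where she guards the whole ring, and the win is passed back along the steps. Larger
  \<open>w\<close> are pushed down to \<open>0\<close> by the phase alone: with all tracks at
  \<open>0\<close> no gate is occupied and the vault is guarded.\<close>

lemma ring_won_start: "w < len \<Longrightarrow> ring_won (\<lambda>_. 0) (w mod 3) w"
proof (induction w)
  case 0
  have k1: "k - 1 < k" using k by simp
  have ok: "tracks_ok (fill k top (\<lambda>_. 0))" by (simp add: tracks_ok_def fill_def)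
  have "state_won (fill k top (\<lambda>_. 0), len - 4)"
    unfolding state_won_def ring_won_def
  proof (intro allI impI)
    fix x y assume xy: "x < d" "y < q"
    show "wins (team (fst (fill k top (\<lambda>_. 0), len - 4)) (snd (fill k top (\<lambda>_. 0), len - 4) mod 3))
        (Rob (Ring (snd (fill k top (\<lambda>_. 0), len - 4))) x y)"
      unfolding fst_conv snd_conv
      by (rule wins_guarded[OF ok _ k1]) (use k1 xy pos(3) in \<open>simp_all add: fill_def\<close>)
  qed
  moreover have "step\<^sup>*\<^sup>* (fill k 0 (\<lambda>_. 0), 0) (fill k top (\<lambda>_. 0), len - 4)"
    by (rule traverse) (simp_all add: tracks_ok_def)
  ultimately have "state_won (fill k 0 (\<lambda>_. 0), 0)" by (rule reach_won[rotated])
  moreover have "fill k 0 (\<lambda>_. 0) = (\<lambda>_. 0)" by (auto simp: fill_def)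
  ultimately show ?case by (simp add: state_won_def)
next
  case (Suc w)
  show ?case
  proof (rule push[where A' = "\<lambda>_. 0" and w' = w])
    show "near (Ring (Suc w)) (Ring w)" using Suc.prems by simp
    show "ring_won (\<lambda>_. 0) (w mod 3) w" using Suc by simp
    show "lawful (\<lambda>_. 0) (Suc w)" by (simp add: lawful_def consistent_def)
  qed (use Suc.prems in \<open>simp_all add: tracks_ok_def\<close>)
qed

theorem cops_win_G: "\<exists>n. cops_win_within G k n"
proof -
  let ?P = "team (\<lambda>_. 0) 0"
  have ok: "tracks_ok (\<lambda>_. 0)" by (simp add: tracks_ok_def)
  have f: "(0 :: nat) < 3" by simp
  have k1: "k - 1 < k" "0 < k" using k by simp_all
  have "wins ?P r" if r: "vert_ok r" for r
  proof (cases r)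
    case (Rob s x y)
    have guarded: ?thesis if "t < k" "guards t 0 0 s" for t
      using wins_guarded[OF ok f that(1), of s x y] that r Rob by simp
    show ?thesis
    proof (cases s)
      case (Ring w)
      show ?thesis
      proof (cases "w mod 3 = 0")
        case True
        then show ?thesis using ring_won_start[of w] r Rob Ring by (simp add: ring_won_def)
      next
        case False
        then show ?thesis using guarded[of 0] Ring k1 by simp
      qed
    \<comment> \<open>At position \<open>0\<close> every haven, the vault and all alarms are
      guarded.\<close>
    qed (use guarded[of "k - 1"] guarded k1 r Rob in auto)
  qed (use r wins_Cop[OF ok f] wins_Hub[OF ok f] wins_Leaf[OF ok f] in auto)
  then obtain N where N: "\<And>r. vert_ok r \<Longrightarrow> win_in G k (N r) ?P r"
    unfolding wins_def by metis
  have "win_in G k (Max (N ` pverts G)) ?P r" if "r \<in> pverts G" for r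
    using N[of r] that finite_pverts_G by (intro win_in_mono[OF N[of r]] Max_ge) simp_all
  moreover have "\<forall>i<k. ?P i \<in> pverts G" using team_ok[OF ok f] by simp
  ultimately show ?thesis unfolding cops_win_within_iff by blast
qed


section \<open>Parameters of the graph, padding and asymptotics\<close>

lemma cop_number_G: "cop_number G = k"
  unfolding cop_number_def
proof (rule Least_equality)
  show "cops_win G k" using cops_win_G cops_win_within_imp_win by blast
  fix j assume "cops_win G j"
  then show "k \<le> j"
    using cops_win_imp_within[OF finite_pverts_G] few_cops_lose by (metis not_le)
qed

lemma capture_time_G: "M ^ (k + 1) \<le> capture_time G"
proof -
  have "cops_win_within G k (capture_time G)"
    using cops_win_within_capture_time[OF finite_pverts_G] by (simp only: cop_number_G)
  then have "(2 * M) ^ k * (len - 4) \<le> capture_time G"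
    using slow by (simp only: span_eq of_nat_le_iff)
  \<comment> \<open>Here \<open>len - 4\<close> is \<open>3 * M - 1\<close>, which is at least
    \<open>M\<close>.\<close>
  moreover have "M ^ k * M \<le> (2 * M) ^ k * (len - 4)"
    using M by (intro mult_le_mono power_mono) (simp_all add: len_def)
  ultimately show ?thesis unfolding power_add power_one_right by (rule order_trans[rotated])
qed

end

lemma slow_graph_exists:
  fixes k :: nat
  assumes k: "2 \<le> k"
  obtains C where "0 < C"
    "\<And>M n. 1 \<le> M \<Longrightarrow> C * M \<le> n \<Longrightarrow> \<exists>H :: nat pair_pre_digraph.
      pair_graph H \<and> card (pverts H) = n \<and> cop_number H = k \<and> M ^ (k + 1) \<le> capture_time H"
proof -
  define D where "D = (2 * k + 1) * ((2 * k + 1) * (4 + 3 * k))\<^sup>2"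
  \<comment> \<open>\<open>M \<ge> 1\<close> absorbs the constant terms of the vertex count
    \<open>b\<close> below, taken without leaves; the remaining \<open>n - b\<close> vertices are
    leaves.\<close>
  define C where "C = 21 * k + (7 + 3 * k) * D + 1"
  have "\<exists>H :: nat pair_pre_digraph.
      pair_graph H \<and> card (pverts H) = n \<and> cop_number H = k \<and> M ^ (k + 1) \<le> capture_time H"
    if M: "1 \<le> M" and n: "C * M \<le> n" for M n
  proof -
    define b where "b = 3 * k * (4 * M + 3) + (3 * M + 4 + 3 * k) * D + 1"
    have "(4 + 3 * k) * 1 \<le> (4 + 3 * k) * M" using M by (rule mult_le_mono2)
    then have "3 * M + 4 + 3 * k \<le> (7 + 3 * k) * M" by (simp add: algebra_simps)
    then have "(3 * M + 4 + 3 * k) * D \<le> (7 + 3 * k) * M * D" by (rule mult_le_mono1)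
    moreover have "3 * k * (4 * M + 3) \<le> 3 * k * (7 * M)" using M by (intro mult_le_mono2) simp
    moreover have "C * M = 3 * k * (7 * M) + (7 + 3 * k) * M * D + M"
      by (simp add: C_def algebra_simps)
    ultimately have "b \<le> C * M" using M unfolding b_def by linarith
    then have "b \<le> n" using n by linarith
    then obtain e where e: "n = b + e" by (rule less_eqE)
    interpret chase k M e by unfold_locales (use k M in auto)
    have "top + 1 = 4 * M + 3" "len + 3 * k + 1 = 3 * M + 4 + 3 * k" "d * q = D"
      by (simp_all add: top_def len_def D_def d_def q_def)
    then have card: "card (pverts G) = n"
      unfolding e b_def by (simp only: card_pverts_G)
    obtain f :: "vert \<Rightarrow> nat" where "inj_on f (pverts G)"
      using finite_imp_inj_to_nat_seg[OF finite_pverts_G] by blast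
    then interpret graph_embedding G f
      by (intro graph_embedding.intro graph_embedding_axioms.intro pair_graph_G)
    have "card (pverts (map_graph f G)) = n"
      using card_image[OF inj] card by simp
    then show ?thesis
      using pair_graph_map cop_number_map cop_number_G capture_time_map capture_time_G by metis
  qed
  then show thesis using that[of C] by (simp add: C_def)
qed

theorem theorem4p6:
  fixes k :: nat
  assumes "k \<ge> 2"
  shows "(\<lambda>n. real (max_capture_time k n)) \<in> \<Theta>(\<lambda>n. real n ^ (k + 1))"
proof -
  obtain C where C: "0 < C"
    "\<And>M n. 1 \<le> M \<Longrightarrow> C * M \<le> n \<Longrightarrow> \<exists>H :: nat pair_pre_digraph.
      pair_graph H \<and> card (pverts H) = n \<and> cop_number H = k \<and> M ^ (k + 1) \<le> capture_time H"
    using slow_graph_exists[OF assms] by blast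
  define T where "T n = {capture_time H | H :: nat pair_pre_digraph.
      pair_graph H \<and> card (pverts H) = n \<and> cop_number H = k}" for n
  have T_le: "t \<le> n ^ (k + 1)" if t: "t \<in> T n" for t n
  proof -
    obtain H :: "nat pair_pre_digraph" where H: "t = capture_time H" "pair_graph H"
        "card (pverts H) = n" "cop_number H = k"
      using t unfolding T_def by blast
    interpret pair_graph H by (rule H(2))
    show ?thesis using capture_time_le[OF pair_finite_verts] H by simp
  qed
  \<comment> \<open>\<open>Max\<close> is meaningful only on a finite nonempty set: the upper bound
    gives finiteness, and the constructed graphs give nonemptiness once
    \<open>n \<ge> C\<close>.\<close>
  have finT: "finite (T n)" for n
    using T_le[of _ n] by (intro finite_subset[of "T n" "{..n ^ (k + 1)}"]) auto
  have max_eq: "max_capture_time k n = Max (T n)" for n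
    by (simp add: max_capture_time_def T_def)
  have bounds: "max_capture_time k n \<le> n ^ (k + 1)"
      "(real n / (2 * real C)) ^ (k + 1) \<le> real (max_capture_time k n)" if n: "n \<ge> C" for n
  proof -
    define M where "M = n div C"
    have M: "1 \<le> M" using n C(1) by (simp add: M_def Suc_leI div_greater_zero_iff)
    have CM: "C * M \<le> n" by (simp add: M_def)
    obtain t where t: "t \<in> T n" "M ^ (k + 1) \<le> t"
      using C(2)[OF M CM] unfolding T_def by blast
    have "Max (T n) \<in> T n" using finT t(1) by (intro Max_in) auto
    then show "max_capture_time k n \<le> n ^ (k + 1)" unfolding max_eq by (rule T_le)
    \<comment> \<open>Rounding down to \<open>n div C\<close> loses at most a factor of two, hence
      the constant \<open>2 * C\<close>.\<close>
    have "n < C * (M + 1)"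
      unfolding M_def using C(1) dividend_less_times_div[of C n] by (simp add: algebra_simps)
    also have "\<dots> \<le> C * (2 * M)" using M by (intro mult_le_mono2) simp
    finally have "real n \<le> real (C * (2 * M))" by (intro of_nat_mono) simp
    then have "real n / (2 * real C) \<le> real M" using C(1) by (simp add: field_simps)
    then have "(real n / (2 * real C)) ^ (k + 1) \<le> real M ^ (k + 1)"
      by (intro power_mono) simp_all
    also have "\<dots> \<le> real t" using t(2) by (metis of_nat_le_iff of_nat_power)
    also have "\<dots> \<le> real (max_capture_time k n)"
      unfolding max_eq using finT t(1) by (intro of_nat_mono Max_ge)
    finally show "(real n / (2 * real C)) ^ (k + 1) \<le> real (max_capture_time k n)" .
  qed
  show ?thesis
  proof (rule bigthetaI)
    show "(\<lambda>n. real (max_capture_time k n)) \<in> O(\<lambda>n. real n ^ (k + 1))"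
    proof (rule landau_o.bigI[of 1])
      show "\<forall>\<^sub>F n in sequentially. norm (real (max_capture_time k n)) \<le> 1 * norm (real n ^ (k + 1))"
        using eventually_ge_at_top[of C]
      proof eventually_elim
        case (elim n)
        then have "real (max_capture_time k n) \<le> real (n ^ (k + 1))"
          using bounds(1) by (intro of_nat_mono) simp
        then show ?case by simp
      qed
    qed simp
    show "(\<lambda>n. real (max_capture_time k n)) \<in> \<Omega>(\<lambda>n. real n ^ (k + 1))"
    proof (rule landau_omega.bigI[of "(1 / (2 * real C)) ^ (k + 1)"])
      show "0 < (1 / (2 * real C)) ^ (k + 1)" using C(1) by simp
      show "\<forall>\<^sub>F n in sequentially.
          (1 / (2 * real C)) ^ (k + 1) * norm (real n ^ (k + 1)) \<le> norm (real (max_capture_time k n))"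
        using eventually_ge_at_top[of C]
      proof eventually_elim
        case (elim n)
        have "(1 / (2 * real C)) ^ (k + 1) * real n ^ (k + 1) = (real n / (2 * real C)) ^ (k + 1)"
          by (simp only: power_mult_distrib[symmetric]) simp
        moreover have "norm (real m) = real m" "norm (real m ^ j) = real m ^ j" for m j by simp_all
        ultimately show ?case using bounds(2)[OF elim] by (simp only:)
      qed
    qed
  qed
qed

end
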